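(* Let $N$ be an ordered negative support family for $\mathbf v_0$. Suppose that there exists $I\in N$ such that $$\widehat Q_N:\bigl(\widehat m_N(\mathbf t)\,\mathbf t^{I\setminus K_N}\bigr)=\widehat Q_N:\widehat m_N(\mathbf t).$$ Then $$\Phi(\widehat Q_N:\widehat m_N(\mathbf t))=P_N:m_N(\mathbf s).$$
   Context: $\mathbb N$ is the set of nonnegative integers. Let $A=(\mathbf a_1,\dots,\mathbf a_n)=(a_{ij})$ be a $d\times n$ integer matrix of rank $d$ whose columns all lie in a single affine hyperplane of $\mathbb Q^d$ not passing through the origin. Put $L=\operatorname{Ker}_{\mathbb Z}(A)\subset\mathbb Z^n$ and $L_{\mathbb C}=\operatorname{Ker}_{\mathbb C}(A)$. The toric ideal is $I_A=\langle\partial_{\mathbf x}^{\mathbf u}-\partial_{\mathbf x}^{\mathbf v}\mid A\mathbf u=A\mathbf v,\ \mathbf u,\mathbf v\in\mathbb N^n\rangle\subset\mathbb C[\partial_1,\dots,\partial_n]$. For $\boldsymbol\beta\in\mathbb C^d$, $H_A(\boldsymbol\beta)$ is the left ideal of the Weyl algebra $D$ in $x_j,\partial_j$ generated by $I_A$ and the operators $\sum_j a_{ij}\theta_j-\beta_i$ ($1\le i\le d$), $\theta_j=x_j\partial_j$. Fix a generic weight $\mathbf w\in\mathbb R^n$, i.e. such that $\operatorname{in}_{\mathbf w}(I_A)$ (generated by the parts of maximal $\mathbf w$-weight of elements of $I_A$) is a monomial ideal, and a fake exponent $\mathbf v_0\in\mathbb C^n$ of $H_A(\boldsymbol\beta)$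 with respect to $\mathbf w$, i.e. a zero of $(D\operatorname{in}_{\mathbf w}(I_A)\cap\mathbb C[\boldsymbol\theta])+\langle A\boldsymbol\theta-\boldsymbol\beta\rangle\subset\mathbb C[\boldsymbol\theta]$. For $\mathbf u\in L$ put $I_{\mathbf u}=\{j\mid(\mathbf v_0+\mathbf u)_j\in\mathbb Z_{<0}\}$; put $\mathrm{NS}=\{I_{\mathbf u}\mid\mathbf u\in L\}$ and $\mathcal N_{\mathbf v_0}=\{I\in\mathrm{NS}\mid \mathbf w\cdot\mathbf u\ge0\text{ for every }\mathbf u\in L\text{ with }I_{\mathbf u}=I\}$. A negative support family for $\mathbf v_0$ is a set $N$ with $I_{\mathbf 0}\in N\subset\mathcal N_{\mathbf v_0}$; it is ordered if $I\in N$, $J\in\mathrm{NS}$, $J\subset I$ imply $J\in N$. Put $N^c=\mathrm{NS}\setminus N$ and $K_N=\bigcap_{I\in N}I$. Ambient side: $\mathbf t=(t_1,\dots,t_n)$, $\mathbf t^S=\prod_{j\in S}t_j$ (empty product $=1$). In $\mathbb C[[\mathbf t]]$ put $\widehat m_N(\mathbf t)=\mathbf t^{I_{\mathbf 0}\setminus K_N}$, $\widehat M_N=\langle\mathbf t^{I\setminus K_N}\mid I\in N\rangle$, $\widehat P_N=\langle\mathbf t^{(I\cup J)\setminus K_N}\mid I\in N,J\in N^c\rangle$, $\langle A\mathbf t\rangle=\langle\sum_j a_{ij}t_j\mid1\le i\le d\rangle$, $\widehat Q_N=\langle A\mathbf t\rangle\widehat M_N+\widehat P_N$. Intrinsic side: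 fix a basis $\mathbf b^{(1)},\dots,\mathbf b^{(n-d)}$ of $L_{\mathbb C}$, also viewed as the matrix $B$ with these columns; $\mathbf s=(s_1,\dots,s_{n-d})$, $(B\mathbf s)_j=\sum_k b^{(k)}_j s_k$, $(B\mathbf s)^S=\prod_{j\in S}(B\mathbf s)_j$. In $\mathbb C[[\mathbf s]]$ put $m_N(\mathbf s)=(B\mathbf s)^{I_{\mathbf 0}\setminus K_N}$ and $P_N=\langle(B\mathbf s)^{(I\cup J)\setminus K_N}\mid I\in N,J\in N^c\rangle$. $\Phi:\mathbb C[[\mathbf t]]\to\mathbb C[[\mathbf s]]$ is the $\mathbb C$-algebra homomorphism $f\mapsto f((B\mathbf s)_1,\dots,(B\mathbf s)_n)$. $J:m=\{f\mid fm\in J\}$ (formed in the respective power series ring). *)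

theory Defs
  imports
    "HOL-Analysis.Cartesian_Space"
    "HOL-Library.Poly_Mapping"
    "HOL-Algebra.Ideal_Product"
    "HOL-Algebra.Algebraic_Closure_Type"
begin

abbreviation "lookup \<equiv> Poly_Mapping.lookup"
abbreviation "keys \<equiv> Poly_Mapping.keys"
abbreviation "single \<equiv> Poly_Mapping.single"


section \<open>Multivariate formal power series\<close>

typedef ('v, 'a) mfps = "UNIV :: (('v \<Rightarrow>\<^sub>0 nat) \<Rightarrow> 'a) set"
  morphisms mfps_coeff Abs_mfps
  by simp

setup_lifting type_definition_mfps

lemma mfps_eqI: "(\<And>m. mfps_coeff f m = mfps_coeff g m) \<Longrightarrow> f = g"
  by transfer auto

lemma finite_monom_le: "finite {a :: 'v \<Rightarrow>\<^sub>0 nat. \<exists>b. a + b = m}"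
proof -
  let ?F = "{f. \<forall>x. (x \<in> keys m \<longrightarrow> f x \<in> {..sum (lookup m) (keys m)}) \<and> (x \<notin> keys m \<longrightarrow> f x = 0)}"
  have "finite ?F"
    by (rule finite_set_of_finite_funs) auto
  moreover have "lookup ` {a. \<exists>b. a + b = m} \<subseteq> ?F"
  proof clarify
    fix b a :: "'v \<Rightarrow>\<^sub>0 nat" and x
    assume m: "m = a + b"
    have le: "lookup a y \<le> lookup m y" for y
      by (simp add: m lookup_add)
    have "lookup m x \<le> sum (lookup m) (keys m)" if "x \<in> keys m"
      using that by (intro member_le_sum) auto
    with le[of x] show "(x \<in> keys (a + b) \<longrightarrow> lookup a x \<in> {..sum (lookup (a + b)) (keys (a + b))})
        \<and> (x \<notin> keys (a + b) \<longrightarrow> lookup a x = 0)"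
      by (auto simp flip: m simp: in_keys_iff)
  qed
  ultimately have "finite (lookup ` {a. \<exists>b. a + b = m})"
    by (rule finite_subset[rotated])
  thus ?thesis
    by (rule finite_imageD) (auto simp: inj_on_def intro: poly_mapping_eqI)
qed

lemma finite_monom_split: "finite {(a, b). a + b = (m :: 'v \<Rightarrow>\<^sub>0 nat)}"
proof (rule finite_subset)
  show "{(a, b). a + b = m} \<subseteq> {a. \<exists>b. a + b = m} \<times> {a. \<exists>b. a + b = m}"
    using add.commute by fastforce
  show "finite ({a. \<exists>b. a + b = m} \<times> {a. \<exists>b. a + b = m})"
    by (intro finite_cartesian_product finite_monom_le)
qed

lift_definition mfps_const :: "'a :: zero \<Rightarrow> ('v, 'a) mfps" is
  "\<lambda>c m. if m = 0 then c else 0" .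

lift_definition mfps_var :: "'v \<Rightarrow> ('v, 'a :: zero_neq_one) mfps" is
  "\<lambda>j m. if m = single j 1 then 1 else 0" .

instantiation mfps :: (type, comm_ring_1) comm_ring_1
begin

lift_definition zero_mfps :: "('a, 'b) mfps" is "\<lambda>_. 0" .
lift_definition one_mfps :: "('a, 'b) mfps" is "\<lambda>m. if m = 0 then 1 else 0" .
lift_definition plus_mfps :: "('a, 'b) mfps \<Rightarrow> ('a, 'b) mfps \<Rightarrow> ('a, 'b) mfps" is
  "\<lambda>f g m. f m + g m" .
lift_definition minus_mfps :: "('a, 'b) mfps \<Rightarrow> ('a, 'b) mfps \<Rightarrow> ('a, 'b) mfps" is
  "\<lambda>f g m. f m - g m" .
lift_definition uminus_mfps :: "('a, 'b) mfps \<Rightarrow> ('a, 'b) mfps" is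
  "\<lambda>f m. - f m" .
lift_definition times_mfps :: "('a, 'b) mfps \<Rightarrow> ('a, 'b) mfps \<Rightarrow> ('a, 'b) mfps" is
  "\<lambda>f g m. \<Sum>(a, b)\<in>{(a, b). a + b = m}. f a * g b" .

instance
proof
  fix f g h :: "('a, 'b) mfps"
  show "f + g + h = f + (g + h)" "f + g = g + f" "0 + f = f" "- f + f = 0" "f - g = f + - g"
    by (transfer; simp add: algebra_simps fun_eq_iff)+
  show "(0 :: ('a, 'b) mfps) \<noteq> 1"
    by transfer (auto simp: fun_eq_iff)
  show "(f + g) * h = f * h + g * h"
    by transfer (simp add: fun_eq_iff case_prod_unfold algebra_simps sum.distrib)
  show "f * g = g * f"
    by transfer
      (auto simp: fun_eq_iff case_prod_unfold add.commute mult.commute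
        intro!: sum.reindex_bij_witness[where i = prod.swap and j = prod.swap])
  show "1 * f = f"
  proof (transfer, rule ext)
    fix f :: "('a \<Rightarrow>\<^sub>0 nat) \<Rightarrow> 'b" and m :: "'a \<Rightarrow>\<^sub>0 nat"
    have "(\<Sum>(a, b)\<in>{(a, b). a + b = m}. (if a = 0 then 1 else 0) * f b)
        = (\<Sum>(a, b)\<in>{(0 :: 'a \<Rightarrow>\<^sub>0 nat, m)}. (if a = 0 then 1 else 0) * f b)"
      by (rule sum.mono_neutral_right[OF finite_monom_split]) (auto split: if_splits)
    thus "(\<Sum>(a, b)\<in>{(a, b). a + b = m}. (if a = 0 then 1 else 0) * f b) = f m"
      by simp
  qed
  show "f * g * h = f * (g * h)"
  proof (transfer, rule ext)
    fix f g h :: "('a \<Rightarrow>\<^sub>0 nat) \<Rightarrow> 'b" and m :: "'a \<Rightarrow>\<^sub>0 nat"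
    have "(\<Sum>(p, c)\<in>{(p, c). p + c = m}. (\<Sum>(a, b)\<in>{(a, b). a + b = p}. f a * g b) * h c)
      = (\<Sum>(q, r)\<in>(SIGMA q:{(p, c). p + c = m}. {(a, b). a + b = fst q}).
           f (fst r) * g (snd r) * h (snd q))"
      by (simp add: case_prod_unfold sum_distrib_right finite_monom_split[unfolded case_prod_unfold]
          sum.Sigma)
    also have "\<dots> = (\<Sum>(q, r)\<in>(SIGMA q:{(a, p). a + p = m}. {(b, c). b + c = snd q}).
           f (fst q) * (g (fst r) * h (snd r)))"
      by (rule sum.reindex_bij_witness[where
            i = "\<lambda>((a, p), (b, c)). ((a + b, c), (a, b))" and
            j = "\<lambda>((p, c), (a, b)). ((a, b + c), (b, c))"])
         (auto simp: add.assoc mult.assoc)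
    also have "\<dots> = (\<Sum>(a, p)\<in>{(a, p). a + p = m}. f a * (\<Sum>(b, c)\<in>{(b, c). b + c = p}. g b * h c))"
      by (simp add: case_prod_unfold sum_distrib_left finite_monom_split[unfolded case_prod_unfold]
          sum.Sigma)
    finally show "(\<Sum>(p, c)\<in>{(p, c). p + c = m}. (\<Sum>(a, b)\<in>{(a, b). a + b = p}. f a * g b) * h c)
      = (\<Sum>(a, p)\<in>{(a, p). a + p = m}. f a * (\<Sum>(b, c)\<in>{(b, c). b + c = p}. g b * h c))" .
  qed
qed

end

text \<open>The ring of power series in the variables indexed by \<open>V\<close>. A set of variables, rather than a
  type, is used because there may be no variable at all (no parameter \<open>s\<close> when \<open>n = d\<close>).\<close>

definition mfps_ring :: "'v set \<Rightarrow> ('v, 'a :: comm_ring_1) mfps ring" where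
  "mfps_ring V = ring_of_type_algebra
     \<lparr>carrier := {f. \<forall>m. mfps_coeff f m \<noteq> 0 \<longrightarrow> keys m \<subseteq> V}\<rparr>"

lemma cring_mfps_ring: "cring (mfps_ring V :: ('v, 'a :: comm_ring_1) mfps ring)"
proof -
  interpret U: cring "ring_of_type_algebra :: ('v, 'a) mfps ring"
    by (rule cring_from_type_algebra)
  let ?C = "{f :: ('v, 'a) mfps. \<forall>m. mfps_coeff f m \<noteq> 0 \<longrightarrow> keys m \<subseteq> V}"
  have uminus: "\<ominus>\<^bsub>ring_of_type_algebra\<^esub> f = - f" for f :: "('v, 'a) mfps"
    by (rule U.minus_equality) (auto simp: ring_of_type_algebra_def)
  have "subcring ?C ring_of_type_algebra"
  proof (rule U.subcringI', rule U.subringI)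
    show "\<one>\<^bsub>ring_of_type_algebra\<^esub> \<in> ?C"
      by (auto simp: ring_of_type_algebra_def one_mfps.rep_eq split: if_splits)
    show "\<ominus>\<^bsub>ring_of_type_algebra\<^esub> f \<in> ?C" if "f \<in> ?C" for f
      unfolding uminus using that by (simp add: uminus_mfps.rep_eq)
    show "f \<oplus>\<^bsub>ring_of_type_algebra\<^esub> g \<in> ?C" if "f \<in> ?C" "g \<in> ?C" for f g
    proof -
      have "keys m \<subseteq> V" if "mfps_coeff f m + mfps_coeff g m \<noteq> 0" for m
      proof (cases "mfps_coeff f m = 0")
        case True
        with that \<open>g \<in> ?C\<close> show ?thesis by simp
      next
        case False
        with \<open>f \<in> ?C\<close> show ?thesis by simp
      qed
      thus ?thesis by (simp add: ring_of_type_algebra_def plus_mfps.rep_eq)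
    qed
    show "f \<otimes>\<^bsub>ring_of_type_algebra\<^esub> g \<in> ?C" if fg: "f \<in> ?C" "g \<in> ?C" for f g
    proof -
      have "keys m \<subseteq> V"
        if nz: "(\<Sum>(a, b)\<in>{(a, b). a + b = m}. mfps_coeff f a * mfps_coeff g b) \<noteq> 0" for m
      proof -
        obtain a b where "a + b = m" and nz': "mfps_coeff f a * mfps_coeff g b \<noteq> 0"
          using sum.not_neutral_contains_not_neutral[OF nz] by auto
        have "mfps_coeff f a \<noteq> 0" "mfps_coeff g b \<noteq> 0"
          using nz' by auto
        with fg have "keys a \<subseteq> V" "keys b \<subseteq> V" by auto
        with \<open>a + b = m\<close> show ?thesis
          using Poly_Mapping.keys_add[of a b] by blast
      qed
      thus ?thesis by (simp add: ring_of_type_algebra_def times_mfps.rep_eq)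
    qed
  qed (auto simp: ring_of_type_algebra_def)
  thus ?thesis
    unfolding mfps_ring_def by (rule U.subcring_iff[THEN iffD1, rotated]) (auto simp: ring_of_type_algebra_def)
qed

definition monom_degree :: "('v \<Rightarrow>\<^sub>0 nat) \<Rightarrow> nat" where
  "monom_degree m = sum (lookup m) (keys m)"

lemma finite_monom_degree_le: "finite {a :: 'v :: finite \<Rightarrow>\<^sub>0 nat. monom_degree a \<le> d}"
proof -
  have "lookup a x \<le> d" if "monom_degree a \<le> d" for a :: "'v \<Rightarrow>\<^sub>0 nat" and x
  proof (cases "x \<in> keys a")
    case True
    hence "lookup a x \<le> monom_degree a"
      unfolding monom_degree_def by (intro member_le_sum) auto
    with that show ?thesis by simp
  qed (simp add: in_keys_iff)
  hence "lookup ` {a :: 'v \<Rightarrow>\<^sub>0 nat. monom_degree a \<le> d} \<subseteq> {f. \<forall>x. (x \<in> UNIV \<longrightarrow> f x \<in> {..d}) \<and> (x \<notin> UNIV \<longrightarrow> f x = 0)}"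
    by auto
  moreover have "finite {f. \<forall>x :: 'v. (x \<in> UNIV \<longrightarrow> f x \<in> {..d}) \<and> (x \<notin> UNIV \<longrightarrow> f x = 0)}"
    by (rule finite_set_of_finite_funs) auto
  ultimately have "finite (lookup ` {a :: 'v \<Rightarrow>\<^sub>0 nat. monom_degree a \<le> d})"
    by (rule finite_subset)
  thus ?thesis
    by (rule finite_imageD) (auto simp: inj_on_def intro: poly_mapping_eqI)
qed

text \<open>Substitution \<open>f(g\<^sub>1, \<dots>, g\<^sub>n)\<close>, for series \<open>g j\<close> without constant term: then
  \<open>g\<^sup>a\<close> only has monomials of degree at least that of \<open>a\<close>, so that the finitely many \<open>a\<close> with
  \<open>monom_degree a \<le> monom_degree m\<close> account for the whole coefficient of the monomial \<open>m\<close>.\<close>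

lift_definition mfps_subst ::
  "('v :: finite \<Rightarrow> ('u, 'a :: comm_ring_1) mfps) \<Rightarrow> ('v, 'a) mfps \<Rightarrow> ('u, 'a) mfps" is
  "\<lambda>g f m. \<Sum>a | monom_degree a \<le> monom_degree m.
      f a * mfps_coeff (\<Prod>j\<in>UNIV. g j ^ lookup a j) m" .

definition colon :: "('a, 'b) ring_scheme \<Rightarrow> 'a set \<Rightarrow> 'a \<Rightarrow> 'a set" where
  "colon R J m = {f \<in> carrier R. f \<otimes>\<^bsub>R\<^esub> m \<in> J}"


section \<open>Polynomials and the Weyl algebra\<close>

type_synonym 'n cpoly = "('n \<Rightarrow>\<^sub>0 nat) \<Rightarrow>\<^sub>0 complex"

abbreviation cpoly_ring :: "'n cpoly ring" where
  "cpoly_ring \<equiv> ring_of_type_algebra"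

definition cpoly_eval :: "'n :: finite cpoly \<Rightarrow> complex ^ 'n \<Rightarrow> complex" where
  "cpoly_eval p v = (\<Sum>m\<in>keys p. lookup p m * (\<Prod>j\<in>UNIV. (v $ j) ^ lookup m j))"

text \<open>In characteristic zero the Weyl algebra \<open>D\<close> is the algebra of endomorphisms of
  \<open>\<complex>[x\<^sub>1, \<dots>, x\<^sub>n]\<close> generated by the scalars, the multiplications by the \<open>x\<^sub>j\<close> and the partial
  derivatives.\<close>

type_synonym 'n cpoly_op = "'n cpoly \<Rightarrow> 'n cpoly"

definition const_op :: "complex \<Rightarrow> 'n cpoly_op" where
  "const_op c f = single 0 c * f"

definition x_op :: "'n \<Rightarrow> 'n cpoly_op" where
  "x_op j f = single (single j 1) 1 * f"

definition d_op :: "'n \<Rightarrow> 'n cpoly_op" where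
  "d_op j f = (\<Sum>m\<in>keys f.
     single (m - single j 1) (of_nat (lookup m j) * lookup f m))"

definition theta_op :: "'n \<Rightarrow> 'n cpoly_op" where
  "theta_op j = x_op j \<circ> d_op j"

inductive_set weyl_carrier :: "'n cpoly_op set" where
  const: "const_op c \<in> weyl_carrier"
| x: "x_op j \<in> weyl_carrier"
| d: "d_op j \<in> weyl_carrier"
| add: "F \<in> weyl_carrier \<Longrightarrow> G \<in> weyl_carrier \<Longrightarrow> (\<lambda>f. F f + G f) \<in> weyl_carrier"
| mult: "F \<in> weyl_carrier \<Longrightarrow> G \<in> weyl_carrier \<Longrightarrow> F \<circ> G \<in> weyl_carrier"

definition weyl_algebra :: "'n cpoly_op ring" where
  "weyl_algebra = \<lparr>carrier = weyl_carrier, monoid.mult = (\<circ>), one = id,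
     zero = (\<lambda>_. 0), add = (\<lambda>F G f. F f + G f)\<rparr>"

lemma weyl_op_add:
  fixes F :: "'n cpoly_op"
  assumes "F \<in> weyl_carrier"
  shows "F (f + g) = F f + F g"
  using assms
proof (induction arbitrary: f g)
  case (d j)
  let ?h = "\<lambda>m c. single (m - single j 1) (of_nat (lookup m j) * c) :: 'n cpoly"
  have *: "d_op j p = (\<Sum>m\<in>keys f \<union> keys g. ?h m (lookup p m))" if "keys p \<subseteq> keys f \<union> keys g" for p
    unfolding d_op_def using that by (intro sum.mono_neutral_left) (auto simp: in_keys_iff)
  show ?case
    by (simp add: * Poly_Mapping.keys_add lookup_add algebra_simps single_add sum.distrib)
qed (auto simp: const_op_def x_op_def algebra_simps)

lemma ring_weyl_algebra: "ring (weyl_algebra :: 'n cpoly_op ring)"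
proof (rule ringI)
  have single_one: "single 0 1 = (1 :: 'n cpoly)"
    by (rule Poly_Mapping.single_one)
  have id: "(id :: 'n cpoly_op) = const_op 1" and zero: "(\<lambda>_. 0 :: 'n cpoly) = const_op 0"
    by (auto simp: const_op_def fun_eq_iff single_one)
  have const0: "const_op 0 f = 0" for f :: "'n cpoly"
    by (simp add: const_op_def)
  have id_mem: "(id :: 'n cpoly_op) \<in> weyl_carrier"
    unfolding id by (rule weyl_carrier.const)
  have neg: "(\<lambda>f. - F f) \<in> weyl_carrier" if "F \<in> weyl_carrier" for F :: "'n cpoly_op"
  proof -
    have "(\<lambda>f. - F f) = const_op (- 1) \<circ> F"
      by (auto simp: const_op_def fun_eq_iff single_uminus single_one)
    thus ?thesis using that by (auto intro: weyl_carrier.intros)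
  qed
  show "abelian_group (weyl_algebra :: 'n cpoly_op ring)"
    by (rule abelian_groupI)
       (auto simp: weyl_algebra_def fun_eq_iff zero const0 algebra_simps
         intro: weyl_carrier.intros neg intro!: bexI[OF _ neg])
  show "Group.monoid (weyl_algebra :: 'n cpoly_op ring)"
    by (rule monoidI) (auto simp: weyl_algebra_def id_mem intro: weyl_carrier.intros simp flip: comp_assoc)
qed (auto simp: weyl_algebra_def fun_eq_iff weyl_op_add)

definition left_ideal :: "'a set \<Rightarrow> ('a, 'b) ring_scheme \<Rightarrow> bool" where
  "left_ideal I R \<longleftrightarrow> additive_subgroup I R \<and> (\<forall>a\<in>I. \<forall>x\<in>carrier R. x \<otimes>\<^bsub>R\<^esub> a \<in> I)"

definition gen_left_ideal :: "('a, 'b) ring_scheme \<Rightarrow> 'a set \<Rightarrow> 'a set" where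
  "gen_left_ideal R S = \<Inter>{I. left_ideal I R \<and> S \<subseteq> I}"

text \<open>\<open>op_poly T p\<close> is \<open>p(T\<^sub>1, \<dots>, T\<^sub>n)\<close> for pairwise commuting operators \<open>T j\<close>; it embeds
  \<open>\<complex>[\<partial>]\<close> (for \<open>T = d_op\<close>) and \<open>\<complex>[\<theta>]\<close> (for \<open>T = theta_op\<close>) into \<open>D\<close>. Because the
  \<open>T j\<close> commute, the order in which the fold composes them does not matter.\<close>

definition op_monom :: "('n :: finite \<Rightarrow> 'n cpoly_op) \<Rightarrow> ('n \<Rightarrow>\<^sub>0 nat) \<Rightarrow> 'n cpoly_op" where
  "op_monom T m = Finite_Set.fold (\<lambda>j F. (T j ^^ lookup m j) \<circ> F) id UNIV"

definition op_poly :: "('n :: finite \<Rightarrow> 'n cpoly_op) \<Rightarrow> 'n cpoly \<Rightarrow> 'n cpoly_op" where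
  "op_poly T p f = (\<Sum>m\<in>keys p. const_op (lookup p m) (op_monom T m f))"


section \<open>Toric ideals, initial ideals and fake exponents\<close>

definition columns_in_hyperplane :: "int ^ 'n ^ 'd \<Rightarrow> bool" where
  "columns_in_hyperplane A \<longleftrightarrow> (\<exists>(h :: rat ^ 'd) (e :: rat). h \<noteq> 0 \<and> e \<noteq> 0 \<and>
     (\<forall>j. (\<Sum>i\<in>UNIV. h $ i * of_int (A $ i $ j)) = e))"

definition L_int :: "int ^ 'n ^ 'd \<Rightarrow> (int ^ 'n) set" where
  "L_int A = {u. A *v u = 0}"

definition L_cplx :: "int ^ 'n ^ 'd \<Rightarrow> (complex ^ 'n) set" where
  "L_cplx A = {z. map_matrix of_int A *v z = 0}"

definition toric_ideal :: "int ^ 'n ^ 'd \<Rightarrow> 'n :: finite cpoly set" where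
  "toric_ideal A = Idl\<^bsub>cpoly_ring\<^esub> {single u 1 - single v 1 | u v.
     A *v (\<chi> j. int (lookup u j)) = A *v (\<chi> j. int (lookup v j))}"

definition monom_weight :: "real ^ 'n \<Rightarrow> ('n :: finite \<Rightarrow>\<^sub>0 nat) \<Rightarrow> real" where
  "monom_weight w m = (\<Sum>j\<in>UNIV. w $ j * real (lookup m j))"

definition initial_form :: "real ^ 'n \<Rightarrow> 'n :: finite cpoly \<Rightarrow> 'n cpoly" where
  "initial_form w f =
     (\<Sum>m | m \<in> keys f \<and> (\<forall>m'\<in>keys f. monom_weight w m' \<le> monom_weight w m).
        single m (lookup f m))"

definition initial_ideal :: "real ^ 'n \<Rightarrow> 'n :: finite cpoly set \<Rightarrow> 'n cpoly set" where
  "initial_ideal w I = Idl\<^bsub>cpoly_ring\<^esub> (initial_form w ` I)"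

definition monomial_ideal :: "'n cpoly set \<Rightarrow> bool" where
  "monomial_ideal I \<longleftrightarrow> (\<exists>S. I = Idl\<^bsub>cpoly_ring\<^esub> ((\<lambda>m. single m 1) ` S))"

definition generic_weight :: "int ^ 'n ^ 'd \<Rightarrow> real ^ 'n :: finite \<Rightarrow> bool" where
  "generic_weight A w \<longleftrightarrow> monomial_ideal (initial_ideal w (toric_ideal A))"

text \<open>The ideals of \<open>\<complex>[\<theta>]\<close> are written in the polynomial ring: \<open>theta_trace\<close> consists of the
  \<open>p\<close> with \<open>p(\<theta>)\<close> in the left ideal \<open>D in\<^sub>w(I\<^sub>A)\<close>.\<close>

definition theta_trace :: "int ^ 'n ^ 'd \<Rightarrow> real ^ 'n \<Rightarrow> 'n :: finite cpoly set" where
  "theta_trace A w = {p. op_poly theta_op p \<in>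
     gen_left_ideal weyl_algebra (op_poly d_op ` initial_ideal w (toric_ideal A))}"

definition euler_ideal :: "int ^ 'n ^ 'd \<Rightarrow> complex ^ 'd \<Rightarrow> 'n :: finite cpoly set" where
  "euler_ideal A \<beta> = Idl\<^bsub>cpoly_ring\<^esub> (range (\<lambda>i.
     (\<Sum>j\<in>UNIV. single (single j 1) (of_int (A $ i $ j)))
       - single 0 (\<beta> $ i)))"

definition fake_exponent ::
  "int ^ 'n ^ 'd \<Rightarrow> complex ^ 'd \<Rightarrow> real ^ 'n \<Rightarrow> complex ^ 'n :: finite \<Rightarrow> bool" where
  "fake_exponent A \<beta> w v \<longleftrightarrow>
     (\<forall>p \<in> theta_trace A w <+>\<^bsub>cpoly_ring\<^esub> euler_ideal A \<beta>. cpoly_eval p v = 0)"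


section \<open>Negative support families\<close>

definition nsupp :: "complex ^ 'n \<Rightarrow> int ^ 'n \<Rightarrow> 'n set" where
  "nsupp v u = {j. \<exists>k<0. v $ j + of_int (u $ j) = of_int k}"

definition NS :: "int ^ 'n ^ 'd \<Rightarrow> complex ^ 'n \<Rightarrow> 'n set set" where
  "NS A v = nsupp v ` L_int A"

definition min_NS :: "int ^ 'n ^ 'd \<Rightarrow> real ^ 'n \<Rightarrow> complex ^ 'n \<Rightarrow> 'n set set" where
  "min_NS A w v = {I \<in> NS A v. \<forall>u\<in>L_int A. nsupp v u = I \<longrightarrow>
     0 \<le> (\<Sum>j\<in>UNIV. w $ j * of_int (u $ j))}"

definition neg_supp_family ::
  "int ^ 'n ^ 'd \<Rightarrow> real ^ 'n \<Rightarrow> complex ^ 'n \<Rightarrow> 'n set set \<Rightarrow> bool" where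
  "neg_supp_family A w v N \<longleftrightarrow> nsupp v 0 \<in> N \<and> N \<subseteq> min_NS A w v"

definition ordered_family :: "int ^ 'n ^ 'd \<Rightarrow> complex ^ 'n \<Rightarrow> 'n set set \<Rightarrow> bool" where
  "ordered_family A v N \<longleftrightarrow> (\<forall>I\<in>N. \<forall>J\<in>NS A v. J \<subseteq> I \<longrightarrow> J \<in> N)"

text \<open>The intersection \<open>K\<^sub>N\<close> is \<open>\<Inter>N\<close>, and \<open>N\<^sup>c\<close> is \<open>NS A v - N\<close>.\<close>


section \<open>The ambient side\<close>

abbreviation t_ring :: "('n :: finite, complex) mfps ring" where
  "t_ring \<equiv> mfps_ring UNIV"

definition t_monom :: "'n set \<Rightarrow> ('n :: finite, complex) mfps" where
  "t_monom S = (\<Prod>j\<in>S. mfps_var j)"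

definition m_hat :: "complex ^ 'n \<Rightarrow> 'n set set \<Rightarrow> ('n :: finite, complex) mfps" where
  "m_hat v N = t_monom (nsupp v 0 - \<Inter>N)"

definition M_hat :: "'n set set \<Rightarrow> ('n :: finite, complex) mfps set" where
  "M_hat N = Idl\<^bsub>t_ring\<^esub> {t_monom (I - \<Inter>N) | I. I \<in> N}"

definition P_hat ::
  "int ^ 'n ^ 'd \<Rightarrow> complex ^ 'n \<Rightarrow> 'n set set \<Rightarrow> ('n :: finite, complex) mfps set" where
  "P_hat A v N = Idl\<^bsub>t_ring\<^esub> {t_monom ((I \<union> J) - \<Inter>N) | I J. I \<in> N \<and> J \<in> NS A v - N}"

definition At_ideal :: "int ^ 'n ^ 'd \<Rightarrow> ('n :: finite, complex) mfps set" where
  "At_ideal A = Idl\<^bsub>t_ring\<^esub>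
     (range (\<lambda>i. \<Sum>j\<in>UNIV. mfps_const (of_int (A $ i $ j)) * mfps_var j))"

definition Q_hat ::
  "int ^ 'n ^ 'd \<Rightarrow> complex ^ 'n \<Rightarrow> 'n set set \<Rightarrow> ('n :: finite, complex) mfps set" where
  "Q_hat A v N = (At_ideal A \<cdot>\<^bsub>t_ring\<^esub> M_hat N) <+>\<^bsub>t_ring\<^esub> P_hat A v N"


section \<open>The intrinsic side\<close>

text \<open>With \<open>r = n - d\<close>, the basis vectors are \<open>b 0, \<dots>, b (r - 1)\<close>, and \<open>s\<close> stands for the
  variables indexed by \<open>{..<r}\<close>.\<close>

definition basis_of_L :: "int ^ 'n ^ 'd \<Rightarrow> nat \<Rightarrow> (nat \<Rightarrow> complex ^ 'n) \<Rightarrow> bool" where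
  "basis_of_L A r b \<longleftrightarrow> inj_on b {..<r} \<and> vec.independent (b ` {..<r}) \<and>
     vec.span (b ` {..<r}) = L_cplx A"

abbreviation s_ring :: "nat \<Rightarrow> (nat, complex) mfps ring" where
  "s_ring r \<equiv> mfps_ring {..<r}"

definition Bs :: "nat \<Rightarrow> (nat \<Rightarrow> complex ^ 'n) \<Rightarrow> 'n \<Rightarrow> (nat, complex) mfps" where
  "Bs r b j = (\<Sum>k<r. mfps_const (b k $ j) * mfps_var k)"

definition Bs_monom :: "nat \<Rightarrow> (nat \<Rightarrow> complex ^ 'n) \<Rightarrow> 'n set \<Rightarrow> (nat, complex) mfps" where
  "Bs_monom r b S = (\<Prod>j\<in>S. Bs r b j)"

definition m_int :: "nat \<Rightarrow> (nat \<Rightarrow> complex ^ 'n) \<Rightarrow> complex ^ 'n \<Rightarrow> 'n set set \<Rightarrow>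
    (nat, complex) mfps" where
  "m_int r b v N = Bs_monom r b (nsupp v 0 - \<Inter>N)"

definition P_int :: "int ^ 'n ^ 'd \<Rightarrow> nat \<Rightarrow> (nat \<Rightarrow> complex ^ 'n) \<Rightarrow> complex ^ 'n \<Rightarrow> 'n set set \<Rightarrow>
    (nat, complex) mfps set" where
  "P_int A r b v N = Idl\<^bsub>s_ring r\<^esub>
     {Bs_monom r b ((I \<union> J) - \<Inter>N) | I J. I \<in> N \<and> J \<in> NS A v - N}"

definition Phi :: "nat \<Rightarrow> (nat \<Rightarrow> complex ^ 'n) \<Rightarrow> ('n :: finite, complex) mfps \<Rightarrow>
    (nat, complex) mfps" where
  "Phi r b = mfps_subst (Bs r b)"

end

theory Submission
  imports Defs
begin

text \<open>
  Write \<open>m'\<close>, \<open>M'\<^sub>N\<close>, \<open>P'\<^sub>N\<close>, \<open>Q'\<^sub>N\<close> for the ambient objects, which carry a hat in the paper.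
  The homomorphism \<open>\<Phi>\<close> is surjective with kernel \<open>\<langle>At\<rangle>\<close>, and it maps the generators of \<open>P'\<^sub>N\<close> to those
  of \<open>P\<^sub>N\<close>. Hence \<open>\<Phi>(Q'\<^sub>N) \<subseteq> P\<^sub>N\<close>, which gives one inclusion. Conversely, if \<open>\<Phi>(f) m \<in> P\<^sub>N\<close>, then
  \<open>f m' \<in> P'\<^sub>N + \<langle>At\<rangle>\<close>; multiplying by \<open>t\<^bsup>I - K\<^esup> \<in> M'\<^sub>N\<close> moves the second summand into
  \<open>\<langle>At\<rangle>M'\<^sub>N\<close>, so \<open>f m' t\<^bsup>I - K\<^esup> \<in> Q'\<^sub>N\<close>, and the hypothesis on \<open>I\<close> removes the additional factor.

  To identify the kernel, take a left inverse \<open>C\<close> of \<open>B\<close> and let \<open>\<Psi>\<close> substitute \<open>s = Ct\<close>.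
  Then \<open>\<Phi>\<Psi> = id\<close>, and \<open>f - \<Psi>\<Phi>(f)\<close> is a combination of the linear forms \<open>t\<^sub>j - (BCt)\<^sub>j\<close>, which
  vanish on \<open>Ker A\<close> and are therefore in the row space of \<open>A\<close>.
\<close>

no_notation fps_nth (infixl \<open>$\<close> 75)


section \<open>Orders of power series and continuous homomorphisms\<close>

lemma monom_degree_superset:
  assumes "finite S" "keys m \<subseteq> S"
  shows "monom_degree m = sum (lookup m) S"
  unfolding monom_degree_def using assms
  by (intro sum.mono_neutral_left) (auto simp: in_keys_iff)

lemma keys_monom_add: "keys (a + b :: 'v \<Rightarrow>\<^sub>0 nat) = keys a \<union> keys b"
  by (auto simp: in_keys_iff lookup_add)

lemma monom_degree_add: "monom_degree (a + b) = monom_degree a + monom_degree b"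
proof -
  let ?S = "keys a \<union> keys b"
  have "monom_degree (a + b) = sum (lookup (a + b)) ?S"
    by (rule monom_degree_superset) (simp_all add: keys_monom_add)
  also have "\<dots> = sum (lookup a) ?S + sum (lookup b) ?S"
    by (simp add: lookup_add sum.distrib)
  also have "\<dots> = monom_degree a + monom_degree b"
    by (simp add: monom_degree_superset[of ?S])
  finally show ?thesis .
qed

lemma monom_degree_0 [simp]: "monom_degree 0 = 0"
  by (simp add: monom_degree_def)

lemma monom_degree_single [simp]: "monom_degree (single j k) = k"
  by (simp add: monom_degree_def)

text \<open>Such an exponent vector is a function from \<open>V\<close> to \<open>{..d}\<close>
  extended by \<open>0\<close>. A finite set of variables takes the place of a finite type because
  the variables \<open>s\<close> are indexed by \<open>nat\<close>.\<close>

lemma finite_monoms_bounded: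
  assumes "finite V"
  shows "finite {a :: 'v \<Rightarrow>\<^sub>0 nat. keys a \<subseteq> V \<and> monom_degree a \<le> d}"
proof -
  have "lookup a x \<le> d" if "monom_degree a \<le> d" for a :: "'v \<Rightarrow>\<^sub>0 nat" and x
  proof (cases "x \<in> keys a")
    case True
    hence "lookup a x \<le> monom_degree a"
      unfolding monom_degree_def by (intro member_le_sum) auto
    with that show ?thesis by simp
  qed (simp add: in_keys_iff)
  hence "lookup ` {a. keys a \<subseteq> V \<and> monom_degree a \<le> d}
      \<subseteq> {f. \<forall>x. (x \<in> V \<longrightarrow> f x \<in> {..d}) \<and> (x \<notin> V \<longrightarrow> f x = 0)}"
    by (auto simp: in_keys_iff)
  moreover have "finite {f. \<forall>x :: 'v. (x \<in> V \<longrightarrow> f x \<in> {..d}) \<and> (x \<notin> V \<longrightarrow> f x = 0)}"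
    using assms by (intro finite_set_of_finite_funs) auto
  ultimately have "finite (lookup ` {a :: 'v \<Rightarrow>\<^sub>0 nat. keys a \<subseteq> V \<and> monom_degree a \<le> d})"
    by (rule finite_subset)
  thus ?thesis
    by (rule finite_imageD) (auto simp: inj_on_def intro: poly_mapping_eqI)
qed

lemma mfps_coeff_mult:
  "mfps_coeff (f * g) m = (\<Sum>(a, b)\<in>{(a, b). a + b = m}. mfps_coeff f a * mfps_coeff g b)"
  by (simp add: times_mfps.rep_eq)

lemma mfps_coeff_sum: "mfps_coeff (\<Sum>i\<in>S. f i) m = (\<Sum>i\<in>S. mfps_coeff (f i) m)"
  by (induction S rule: infinite_finite_induct) (auto simp: zero_mfps.rep_eq plus_mfps.rep_eq)

lemma mfps_coeff_const_mult:
  fixes f :: "('v, 'a :: comm_ring_1) mfps"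
  shows "mfps_coeff (mfps_const c * f) m = c * mfps_coeff f m"
proof -
  have "mfps_coeff (mfps_const c * f) m
      = (\<Sum>(a, b)\<in>{(0, m)}. mfps_coeff (mfps_const c :: ('v, 'a) mfps) a * mfps_coeff f b)"
    unfolding mfps_coeff_mult
    by (rule sum.mono_neutral_right[OF finite_monom_split])
       (auto simp: mfps_const.rep_eq split: if_splits)
  thus ?thesis by (simp add: mfps_const.rep_eq)
qed

lemma mfps_const_0 [simp]: "mfps_const 0 = 0"
  by transfer auto

lemma mfps_const_1 [simp]: "mfps_const 1 = 1"
  by transfer auto

lemma mfps_const_add: "mfps_const (a + b) = mfps_const a + mfps_const (b :: 'a :: comm_ring_1)"
  by transfer auto

lemma mfps_const_diff: "mfps_const (a - b) = mfps_const a - mfps_const (b :: 'a :: comm_ring_1)"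
  by transfer auto

lemma mfps_const_mult: "mfps_const (a * b) = mfps_const a * mfps_const (b :: 'a :: comm_ring_1)"
  by (rule mfps_eqI, subst mfps_coeff_const_mult) (auto simp: mfps_const.rep_eq)

lemma mfps_const_sum:
  "mfps_const (\<Sum>i\<in>S. f i) = (\<Sum>i\<in>S. mfps_const (f i :: 'a :: comm_ring_1))"
  by (induction S rule: infinite_finite_induct) (auto simp: mfps_const_add)

text \<open>Given by its coefficients, the monomial with exponent \<open>a\<close> makes sense
  without choosing a finite set of variables; \<open>prod_mfps_var_power\<close> recovers the
  product form.\<close>

definition mfps_monom :: "('v \<Rightarrow>\<^sub>0 nat) \<Rightarrow> ('v, 'a :: comm_ring_1) mfps" where
  "mfps_monom a = Abs_mfps (\<lambda>m. if m = a then 1 else 0)"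

lemma mfps_coeff_monom: "mfps_coeff (mfps_monom a) m = (if m = a then 1 else 0)"
  by (simp add: mfps_monom_def Abs_mfps_inverse)

lemma mfps_coeff_monom_mult:
  fixes f :: "('v, 'a :: comm_ring_1) mfps"
  shows "mfps_coeff (mfps_monom a * f) (a + m) = mfps_coeff f m"
proof -
  have "mfps_coeff (mfps_monom a * f) (a + m)
      = (\<Sum>(b, c)\<in>{(a, m)}. mfps_coeff (mfps_monom a :: ('v, 'a) mfps) b * mfps_coeff f c)"
    unfolding mfps_coeff_mult
    by (rule sum.mono_neutral_right[OF finite_monom_split])
       (auto simp: mfps_coeff_monom split: if_splits)
  thus ?thesis by (simp add: mfps_coeff_monom)
qed

lemma mfps_coeff_monom_mult_eq_0:
  assumes "\<And>b. m \<noteq> a + b"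
  shows "mfps_coeff (mfps_monom a * f) m = 0"
  unfolding mfps_coeff_mult using assms
  by (intro sum.neutral) (auto simp: mfps_coeff_monom)

lemma mfps_monom_add: "mfps_monom (a + b) = mfps_monom a * (mfps_monom b :: ('v, 'a :: comm_ring_1) mfps)"
proof (rule mfps_eqI)
  fix m
  show "mfps_coeff (mfps_monom (a + b) :: ('v, 'a) mfps) m = mfps_coeff (mfps_monom a * mfps_monom b) m"
  proof (cases "\<exists>c. m = a + c")
    case True
    then obtain c where m: "m = a + c" by blast
    show ?thesis unfolding m mfps_coeff_monom_mult by (simp add: mfps_coeff_monom)
  next
    case False
    thus ?thesis by (auto simp: mfps_coeff_monom_mult_eq_0 mfps_coeff_monom)
  qed
qed

lemma mfps_monom_0: "mfps_monom 0 = 1"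
  by (rule mfps_eqI) (simp add: mfps_coeff_monom one_mfps.rep_eq)

lemma mfps_monom_sum: "mfps_monom (\<Sum>i\<in>S. f i) = (\<Prod>i\<in>S. mfps_monom (f i))"
  by (induction S rule: infinite_finite_induct) (auto simp: mfps_monom_0 mfps_monom_add)

lemma mfps_var_power:
  "mfps_var j ^ k = (mfps_monom (single j k) :: ('v, 'a :: comm_ring_1) mfps)"
proof (induction k)
  case (Suc k)
  have "single j (Suc k) = single j 1 + single j k"
    by (simp flip: single_add)
  moreover have "mfps_var j = (mfps_monom (single j 1) :: ('v, 'a) mfps)"
    by (rule mfps_eqI) (simp add: mfps_coeff_monom mfps_var.rep_eq)
  ultimately show ?case using Suc by (simp only: power_Suc mfps_monom_add)
qed (simp add: mfps_monom_0)

lemma prod_mfps_var_power: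
  assumes "finite V" "keys a \<subseteq> V"
  shows "(\<Prod>j\<in>V. mfps_var j ^ lookup a j) = mfps_monom a"
proof -
  have "(\<Sum>j\<in>V. single j (lookup a j)) = a"
    using assms by (intro poly_mapping_eqI)
      (auto simp: lookup_sum lookup_single when_def in_keys_iff)
  thus ?thesis
    by (simp add: mfps_var_power flip: mfps_monom_sum)
qed

text \<open>With finitely many variables this is membership in the \<open>n\<close>-th power of the
  ideal generated by the variables. A lower bound, rather than an order, avoids an exceptional value
  for the zero series.\<close>

definition mfps_order_ge :: "nat \<Rightarrow> ('v, 'a :: zero) mfps \<Rightarrow> bool" where
  "mfps_order_ge n f \<longleftrightarrow> (\<forall>m. monom_degree m < n \<longrightarrow> mfps_coeff f m = 0)"

lemma mfps_order_ge_0 [simp]: "mfps_order_ge 0 f"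
  by (simp add: mfps_order_ge_def)

lemma mfps_order_ge_add: "mfps_order_ge n f \<Longrightarrow> mfps_order_ge n g \<Longrightarrow> mfps_order_ge n (f + g)"
  by (simp add: mfps_order_ge_def plus_mfps.rep_eq)

lemma mfps_order_ge_diff: "mfps_order_ge n f \<Longrightarrow> mfps_order_ge n g \<Longrightarrow> mfps_order_ge n (f - g)"
  by (simp add: mfps_order_ge_def minus_mfps.rep_eq)

lemma mfps_order_ge_sum: "(\<And>i. i \<in> S \<Longrightarrow> mfps_order_ge n (f i)) \<Longrightarrow> mfps_order_ge n (\<Sum>i\<in>S. f i)"
  by (auto simp: mfps_order_ge_def mfps_coeff_sum intro: sum.neutral)

lemma mfps_order_ge_var: "mfps_order_ge (Suc 0) (mfps_var j :: ('v, 'a :: zero_neq_one) mfps)"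
  by (auto simp: mfps_order_ge_def mfps_var.rep_eq)

lemma mfps_order_ge_const_mult: "mfps_order_ge n f \<Longrightarrow> mfps_order_ge n (mfps_const c * f)"
  by (simp add: mfps_order_ge_def mfps_coeff_const_mult)

lemma mfps_order_ge_mult:
  assumes "mfps_order_ge k f" "mfps_order_ge l g"
  shows "mfps_order_ge (k + l) (f * g)"
  unfolding mfps_order_ge_def mfps_coeff_mult
proof (intro allI impI sum.neutral ballI, clarify)
  fix a b :: "'a \<Rightarrow>\<^sub>0 nat"
  assume "monom_degree (a + b) < k + l"
  hence "monom_degree a < k \<or> monom_degree b < l"
    unfolding monom_degree_add by linarith
  thus "mfps_coeff f a * mfps_coeff g b = 0"
    using assms by (auto simp: mfps_order_ge_def)
qed

lemma mfps_order_ge_power: "mfps_order_ge (Suc 0) f \<Longrightarrow> mfps_order_ge k (f ^ k)"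
  using mfps_order_ge_mult[of "Suc 0" f] by (induction k) auto

lemma mfps_order_ge_prod:
  "(\<And>i. i \<in> S \<Longrightarrow> mfps_order_ge (n i) (f i)) \<Longrightarrow> mfps_order_ge (sum n S) (prod f S)"
  by (induction S rule: infinite_finite_induct) (auto intro: mfps_order_ge_mult)

text \<open>The last conjunct is a strong form of continuity: it allows a coefficient of
  \<open>F f\<close> to be computed from a polynomial truncation of \<open>f\<close>, as in
  \<open>mfps_hom_eqI\<close>.\<close>

definition mfps_hom :: "(('u, 'a :: comm_ring_1) mfps \<Rightarrow> ('v, 'a) mfps) \<Rightarrow> bool" where
  "mfps_hom F \<longleftrightarrow> (\<forall>f g. F (f + g) = F f + F g) \<and> (\<forall>f g. F (f * g) = F f * F g)
     \<and> (\<forall>c. F (mfps_const c) = mfps_const c)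
     \<and> (\<forall>n f. mfps_order_ge n f \<longrightarrow> mfps_order_ge n (F f))"

lemma mfps_hom_id: "mfps_hom (\<lambda>f. f)"
  by (simp add: mfps_hom_def)

lemma mfps_hom_comp: "mfps_hom F \<Longrightarrow> mfps_hom G \<Longrightarrow> mfps_hom (\<lambda>f. F (G f))"
  by (simp add: mfps_hom_def)

context
  fixes F :: "('u, 'a :: comm_ring_1) mfps \<Rightarrow> ('v, 'a) mfps"
  assumes F: "mfps_hom F"
begin

lemma mfps_hom_add: "F (f + g) = F f + F g"
  and mfps_hom_mult: "F (f * g) = F f * F g"
  and mfps_hom_const: "F (mfps_const c) = mfps_const c"
  and mfps_hom_order_ge: "mfps_order_ge n f \<Longrightarrow> mfps_order_ge n (F f)"
  using F by (simp_all add: mfps_hom_def)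

lemma mfps_hom_0: "F 0 = 0"
  using mfps_hom_const[of 0] by simp

lemma mfps_hom_1: "F 1 = 1"
  using mfps_hom_const[of 1] by simp

lemma mfps_hom_diff: "F (f - g) = F f - F g"
  using mfps_hom_add[of "f - g" g] by (simp add: algebra_simps)

lemma mfps_hom_sum: "F (\<Sum>i\<in>S. f i) = (\<Sum>i\<in>S. F (f i))"
  by (induction S rule: infinite_finite_induct) (auto simp: mfps_hom_0 mfps_hom_add)

lemma mfps_hom_prod: "F (\<Prod>i\<in>S. f i) = (\<Prod>i\<in>S. F (f i))"
  by (induction S rule: infinite_finite_induct) (auto simp: mfps_hom_1 mfps_hom_mult)

lemma mfps_hom_power: "F (f ^ k) = F f ^ k"
  by (induction k) (auto simp: mfps_hom_1 mfps_hom_mult)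

end

lemmas mfps_hom_simps = mfps_hom_add mfps_hom_mult mfps_hom_const mfps_hom_0 mfps_hom_1
  mfps_hom_diff mfps_hom_sum mfps_hom_prod mfps_hom_power

lemma mfps_ring_simps:
  "carrier (mfps_ring V) = {f. \<forall>m. mfps_coeff f m \<noteq> 0 \<longrightarrow> keys m \<subseteq> V}"
  "f \<otimes>\<^bsub>mfps_ring V\<^esub> g = f * g" "f \<oplus>\<^bsub>mfps_ring V\<^esub> g = f + g"
  "\<zero>\<^bsub>mfps_ring V\<^esub> = 0" "\<one>\<^bsub>mfps_ring V\<^esub> = 1"
  by (simp_all add: mfps_ring_def ring_of_type_algebra_def)

text \<open>Modulo series of order exceeding \<open>monom_degree m\<close>, which do not affect the coefficient
  of \<open>m\<close>, a series is a polynomial.\<close>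

lemma mfps_hom_eqI:
  fixes F G :: "('u, 'a :: comm_ring_1) mfps \<Rightarrow> ('v, 'a) mfps"
  assumes F: "mfps_hom F" and G: "mfps_hom G" and V: "finite V"
    and eq: "\<And>j. j \<in> V \<Longrightarrow> F (mfps_var j) = G (mfps_var j)"
    and f: "f \<in> carrier (mfps_ring V)"
  shows "F f = G f"
proof (rule mfps_eqI)
  fix m :: "'v \<Rightarrow>\<^sub>0 nat"
  define T where "T = {a :: 'u \<Rightarrow>\<^sub>0 nat. keys a \<subseteq> V \<and> monom_degree a \<le> monom_degree m}"
  define p where
    "p = (\<Sum>a\<in>T. mfps_const (mfps_coeff f a) * (\<Prod>j\<in>V. mfps_var j ^ lookup a j))"
  have T: "finite T"
    unfolding T_def using V by (rule finite_monoms_bounded)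
  have p: "mfps_coeff p x = (if x \<in> T then mfps_coeff f x else 0)" for x
  proof -
    have "mfps_coeff p x = (\<Sum>a\<in>T. mfps_coeff f a * (if x = a then 1 else 0))"
      unfolding p_def mfps_coeff_sum mfps_coeff_const_mult
      by (rule sum.cong) (auto simp: T_def prod_mfps_var_power[OF V] mfps_coeff_monom)
    also have "\<dots> = (if x \<in> T then mfps_coeff f x else 0)"
      using T by (simp add: if_distrib sum.delta' cong: if_cong)
    finally show ?thesis .
  qed
  \<comment> \<open>A monomial of degree at most \<open>monom_degree m\<close> outside
    \<open>T\<close> would involve a variable outside \<open>V\<close>, which the carrier condition
    on \<open>f\<close> excludes. Hence the remainder starts one degree above
    \<open>m\<close>.\<close>
  have rest: "mfps_order_ge (Suc (monom_degree m)) (f - p)"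
    using f by (auto simp: mfps_order_ge_def minus_mfps.rep_eq p T_def mfps_ring_simps)
  have "F p = G p"
    unfolding p_def by (simp add: mfps_hom_simps[OF F] mfps_hom_simps[OF G] eq cong: prod.cong)
  moreover have "mfps_coeff (F (f - p)) m = 0" "mfps_coeff (G (f - p)) m = 0"
    using mfps_hom_order_ge[OF F rest] mfps_hom_order_ge[OF G rest] by (auto simp: mfps_order_ge_def)
  ultimately show "mfps_coeff (F f) m = mfps_coeff (G f) m"
    by (simp add: mfps_hom_diff[OF F] mfps_hom_diff[OF G] minus_mfps.rep_eq)
qed


section \<open>Substitution\<close>

text \<open>Unlike \<^const>\<open>mfps_subst\<close>, this allows infinite types of variables: those outside
  \<open>V\<close> are sent to \<open>0\<close>.\<close>

lift_definition mfps_subst_on ::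
  "'v set \<Rightarrow> ('v \<Rightarrow> ('u, 'a :: comm_ring_1) mfps) \<Rightarrow> ('v, 'a) mfps \<Rightarrow> ('u, 'a) mfps" is
  "\<lambda>V g f m. \<Sum>a | keys a \<subseteq> V \<and> monom_degree a \<le> monom_degree m.
      f a * mfps_coeff (\<Prod>j\<in>V. g j ^ lookup a j) m" .

lemma mfps_subst_eq: "mfps_subst g = mfps_subst_on UNIV g"
  by (intro ext mfps_eqI) (simp add: mfps_subst.rep_eq mfps_subst_on.rep_eq)

context
  fixes V :: "'v set" and g :: "'v \<Rightarrow> ('u, 'a :: comm_ring_1) mfps"
  assumes V: "finite V" and g: "\<And>j. j \<in> V \<Longrightarrow> mfps_order_ge (Suc 0) (g j)"
begin

private abbreviation "gpow a \<equiv> \<Prod>j\<in>V. g j ^ lookup (a :: 'v \<Rightarrow>\<^sub>0 nat) j"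

private lemma order_ge_mon: "keys a \<subseteq> V \<Longrightarrow> mfps_order_ge (monom_degree a) (gpow a)"
  using V g by (auto simp: monom_degree_superset[of V] intro!: mfps_order_ge_prod mfps_order_ge_power)

private lemma coeff_mon_eq_0:
  "keys a \<subseteq> V \<Longrightarrow> monom_degree m < monom_degree a \<Longrightarrow> mfps_coeff (gpow a) m = 0"
  using order_ge_mon by (auto simp: mfps_order_ge_def)

text \<open>Since \<open>gpow a\<close> has order at least \<open>monom_degree a\<close>, the
  additional terms vanish. A bound \<open>D\<close> independent of \<open>m\<close> lets
  coefficients at different monomials be expanded over the same index set.\<close>

private lemma coeff_subst_on:
  assumes "monom_degree m \<le> D"
  shows "mfps_coeff (mfps_subst_on V g f) m
    = (\<Sum>a | keys a \<subseteq> V \<and> monom_degree a \<le> D. mfps_coeff f a * mfps_coeff (gpow a) m)"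
  unfolding mfps_subst_on.rep_eq
  by (rule sum.mono_neutral_left[OF finite_monoms_bounded[OF V]])
     (use assms in \<open>auto intro: leI dest: coeff_mon_eq_0\<close>)

text \<open>All coefficients at divisors of \<open>m\<close> are expanded with the common bound
  \<open>D\<close>; the resulting double sum over exponents \<open>b\<close>, \<open>c\<close> is
  then regrouped by \<open>a = b + c\<close> into the Cauchy product of \<open>f\<close> and
  \<open>h\<close>.\<close>

private lemma subst_on_mult:
  "mfps_subst_on V g (f * h) = mfps_subst_on V g f * mfps_subst_on V g h"
proof (rule mfps_eqI)
  fix m :: "'u \<Rightarrow>\<^sub>0 nat"
  let ?S = "\<lambda>D. {a :: 'v \<Rightarrow>\<^sub>0 nat. keys a \<subseteq> V \<and> monom_degree a \<le> D}"
  define D where "D = monom_degree m"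
  note fin = finite_monoms_bounded[OF V]
  have deg: "monom_degree p \<le> D" "monom_degree q \<le> D" if "p + q = m" for p q
    using monom_degree_add[of p q] that by (auto simp: D_def)
  have "mfps_coeff (mfps_subst_on V g f * mfps_subst_on V g h) m
    = (\<Sum>(p, q)\<in>{(p, q). p + q = m}. \<Sum>b\<in>?S D. \<Sum>c\<in>?S D.
        (mfps_coeff f b * mfps_coeff (gpow b) p) * (mfps_coeff h c * mfps_coeff (gpow c) q))"
    unfolding mfps_coeff_mult
  proof (intro sum.cong refl, clarify)
    fix p q assume "m = p + q"
    with deg[of p q] have "monom_degree p \<le> D" "monom_degree q \<le> D" by auto
    thus "mfps_coeff (mfps_subst_on V g f) p * mfps_coeff (mfps_subst_on V g h) q
      = (\<Sum>b\<in>?S D. \<Sum>c\<in>?S D.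
        (mfps_coeff f b * mfps_coeff (gpow b) p) * (mfps_coeff h c * mfps_coeff (gpow c) q))"
      by (simp add: coeff_subst_on sum_product)
  qed
  also have "\<dots> = (\<Sum>b\<in>?S D. \<Sum>c\<in>?S D. \<Sum>(p, q)\<in>{(p, q). p + q = m}.
        (mfps_coeff f b * mfps_coeff (gpow b) p) * (mfps_coeff h c * mfps_coeff (gpow c) q))"
    unfolding case_prod_unfold by (subst sum.swap, intro sum.cong refl, rule sum.swap)
  \<comment> \<open>The inner convolution over \<open>p + q = m\<close> is the coefficient at
    \<open>m\<close> of \<open>gpow b * gpow c\<close>, which is
    \<open>gpow (b + c)\<close>.\<close>
  also have "\<dots> = (\<Sum>b\<in>?S D. \<Sum>c\<in>?S D.
      mfps_coeff f b * mfps_coeff h c * mfps_coeff (gpow (b + c)) m)"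
    by (simp add: lookup_add power_add prod.distrib mfps_coeff_mult[of "gpow _"]
        sum_distrib_left case_prod_unfold mult_ac)
  also have "\<dots> = (\<Sum>(b, c)\<in>?S D \<times> ?S D.
      mfps_coeff f b * mfps_coeff h c * mfps_coeff (gpow (b + c)) m)"
    by (simp add: sum.cartesian_product)
  \<comment> \<open>From the square to the triangle: when the total degree of \<open>b + c\<close>
    exceeds \<open>D\<close>, the series \<open>gpow (b + c)\<close> has coefficient
    \<open>0\<close> at \<open>m\<close>.\<close>
  also have "\<dots> = (\<Sum>(b, c)\<in>{(b, c). b + c \<in> ?S D}.
      mfps_coeff f b * mfps_coeff h c * mfps_coeff (gpow (b + c)) m)"
  proof (rule sum.mono_neutral_right)
    show "finite (?S D \<times> ?S D)"
      by (intro finite_cartesian_product fin)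
    show "{(b, c). b + c \<in> ?S D} \<subseteq> ?S D \<times> ?S D"
      by (auto simp: monom_degree_add keys_monom_add)
    show "\<forall>i\<in>?S D \<times> ?S D - {(b, c). b + c \<in> ?S D}.
      (case i of (b, c) \<Rightarrow> mfps_coeff f b * mfps_coeff h c * mfps_coeff (gpow (b + c)) m) = 0"
    proof
      fix i
      assume i: "i \<in> ?S D \<times> ?S D - {(b, c). b + c \<in> ?S D}"
      obtain b c where bc: "i = (b, c)" by fastforce
      with i have "keys (b + c) \<subseteq> V" "\<not> monom_degree (b + c) \<le> D"
        by (auto simp: keys_monom_add)
      hence "mfps_coeff (gpow (b + c)) m = 0"
        by (intro coeff_mon_eq_0) (auto simp: D_def)
      thus "(case i of (b, c) \<Rightarrow> mfps_coeff f b * mfps_coeff h c * mfps_coeff (gpow (b + c)) m) = 0"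
        by (simp add: bc)
    qed
  qed
  also have "\<dots> = (\<Sum>(a, q)\<in>(SIGMA a:?S D. {(b, c). b + c = a}).
      mfps_coeff f (fst q) * mfps_coeff h (snd q) * mfps_coeff (gpow a) m)"
    by (rule sum.reindex_bij_witness[where i = "\<lambda>(a, q). q" and j = "\<lambda>(b, c). (b + c, (b, c))"]) auto
  also have "\<dots> = (\<Sum>a\<in>?S D. mfps_coeff (f * h) a * mfps_coeff (gpow a) m)"
    unfolding mfps_coeff_mult
    by (simp add: case_prod_unfold sum_distrib_right fin finite_monom_split[unfolded case_prod_unfold]
        sum.Sigma)
  also have "\<dots> = mfps_coeff (mfps_subst_on V g (f * h)) m"
    by (simp only: mfps_subst_on.rep_eq D_def)
  finally show "mfps_coeff (mfps_subst_on V g (f * h)) m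
    = mfps_coeff (mfps_subst_on V g f * mfps_subst_on V g h) m" ..
qed

lemma mfps_hom_subst_on: "mfps_hom (mfps_subst_on V g)"
  unfolding mfps_hom_def
proof (intro conjI allI impI)
  show "mfps_subst_on V g (f + h) = mfps_subst_on V g f + mfps_subst_on V g h" for f h
    by (rule mfps_eqI)
       (simp add: mfps_subst_on.rep_eq plus_mfps.rep_eq algebra_simps sum.distrib)
  show "mfps_subst_on V g (f * h) = mfps_subst_on V g f * mfps_subst_on V g h" for f h
    by (rule subst_on_mult)
  show "mfps_subst_on V g (mfps_const c) = mfps_const c" for c
  proof (rule mfps_eqI)
    fix m
    have "mfps_coeff (mfps_subst_on V g (mfps_const c)) m
        = (\<Sum>a\<in>{0}. mfps_coeff (mfps_const c) a * mfps_coeff (gpow a) m)"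
      unfolding mfps_subst_on.rep_eq
      by (rule sum.mono_neutral_right[OF finite_monoms_bounded[OF V]]) (auto simp: mfps_const.rep_eq)
    thus "mfps_coeff (mfps_subst_on V g (mfps_const c)) m = mfps_coeff (mfps_const c) m"
      by (simp add: mfps_const.rep_eq one_mfps.rep_eq)
  qed
  \<comment> \<open>Only exponents \<open>a\<close> of degree at most that of \<open>m\<close> enter
    the coefficient at \<open>m\<close>, and below degree \<open>n\<close> all these coefficients of
    \<open>f\<close> vanish.\<close>
  show "mfps_order_ge n (mfps_subst_on V g f)" if "mfps_order_ge n f" for n f
    using that by (auto simp: mfps_order_ge_def mfps_subst_on.rep_eq intro!: sum.neutral)
qed

lemma mfps_subst_on_var:
  assumes j: "j \<in> V"
  shows "mfps_subst_on V g (mfps_var j) = g j"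
proof (rule mfps_eqI)
  fix m
  have gpow: "gpow (single j 1) = g j"
  proof -
    have "gpow (single j 1) = (\<Prod>i\<in>V. if i = j then g j else 1)"
      by (intro prod.cong) (auto simp: lookup_single when_def)
    thus ?thesis using V j by simp
  qed
  \<comment> \<open>The defining sum stops at \<open>monom_degree m\<close> and so misses
    \<open>single j 1\<close> when \<open>m = 0\<close>; the bound
    \<open>Suc (monom_degree m)\<close> always includes it.\<close>
  have "mfps_coeff (mfps_subst_on V g (mfps_var j)) m
      = (\<Sum>a | keys a \<subseteq> V \<and> monom_degree a \<le> Suc (monom_degree m).
          mfps_coeff (mfps_var j) a * mfps_coeff (gpow a) m)"
    by (rule coeff_subst_on) simp
  also have "\<dots> = (\<Sum>a\<in>{single j 1}. mfps_coeff (mfps_var j) a * mfps_coeff (gpow a) m)"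
    by (rule sum.mono_neutral_right[OF finite_monoms_bounded[OF V]])
       (use j in \<open>auto simp: mfps_var.rep_eq\<close>)
  also have "\<dots> = mfps_coeff (g j) m"
    using gpow by (simp add: mfps_var.rep_eq)
  finally show "mfps_coeff (mfps_subst_on V g (mfps_var j)) m = mfps_coeff (g j) m" .
qed

end

text \<open>This substitution is the projection that sets the variables outside \<open>V\<close> to
  \<open>0\<close>. Its fixed points are the elements of \<open>mfps_ring V\<close>, and its kernel
  consists of the series all of whose monomials involve a variable outside \<open>V\<close>.\<close>

lemma mfps_coeff_subst_on_var:
  assumes "finite V"
  shows "mfps_coeff (mfps_subst_on V mfps_var f) m = (if keys m \<subseteq> V then mfps_coeff f m else 0)"
proof -
  let ?S = "{a. keys a \<subseteq> V \<and> monom_degree a \<le> monom_degree m}"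
  have "mfps_coeff (mfps_subst_on V mfps_var f) m
      = (\<Sum>a\<in>?S. mfps_coeff f a * (if m = a then 1 else 0))"
    unfolding mfps_subst_on.rep_eq using assms
    by (intro sum.cong refl) (auto simp: prod_mfps_var_power mfps_coeff_monom)
  also have "\<dots> = (if keys m \<subseteq> V then mfps_coeff f m else 0)"
    using finite_monoms_bounded[OF assms] by (simp add: if_distrib sum.delta' cong: if_cong)
  finally show ?thesis .
qed

text \<open>Variables are split off one at a time: once every monomial containing \<open>i\<close>
  is removed, the monomials that remain must meet the smaller set \<open>Z\<close>.\<close>

lemma mfps_eq_sum_var_mult:
  fixes f :: "('v, 'a :: comm_ring_1) mfps"
  assumes "finite Z" "\<And>m. mfps_coeff f m \<noteq> 0 \<Longrightarrow> keys m \<inter> Z \<noteq> {}"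
  shows "\<exists>h. f = (\<Sum>j\<in>Z. mfps_var j * h j)"
  using assms
proof (induction Z arbitrary: f rule: finite_induct)
  case empty
  have "f = 0"
    by (rule mfps_eqI) (use empty in \<open>auto simp: zero_mfps.rep_eq\<close>)
  thus ?case by simp
next
  case (insert i Z)
  \<comment> \<open>Dividing by the variable \<open>i\<close> shifts exponents, so
    \<open>mfps_var i * q\<close> is exactly the part of \<open>f\<close> whose monomials contain
    \<open>i\<close>.\<close>
  define q :: "('v, 'a) mfps" where "q = Abs_mfps (\<lambda>m. mfps_coeff f (single i 1 + m))"
  have q: "mfps_coeff q m = mfps_coeff f (single i 1 + m)" for m
    by (simp add: q_def Abs_mfps_inverse)
  have var: "mfps_var i = mfps_monom (single i 1)"
    using mfps_var_power[of i 1] by simp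
  have coeff: "mfps_coeff (mfps_var i * q) m = (if i \<in> keys m then mfps_coeff f m else 0)" for m
  proof (cases "i \<in> keys m")
    case True
    hence "m = single i 1 + (m - single i 1)"
      by (intro poly_mapping_eqI) (auto simp: lookup_add lookup_minus lookup_single when_def in_keys_iff)
    with True show ?thesis
      using mfps_coeff_monom_mult[of "single i 1" q "m - single i 1"] by (simp add: var q)
  next
    case False
    hence "m \<noteq> single i 1 + b" for b
      by (auto simp: in_keys_iff lookup_add)
    with False show ?thesis by (simp add: var mfps_coeff_monom_mult_eq_0)
  qed
  have "\<exists>h. f - mfps_var i * q = (\<Sum>j\<in>Z. mfps_var j * h j)"
    by (rule insert.IH)
       (use insert.prems in \<open>force simp: minus_mfps.rep_eq coeff split: if_splits\<close>)
  then obtain h where "f - mfps_var i * q = (\<Sum>j\<in>Z. mfps_var j * h j)" ..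
  moreover have "(\<Sum>j\<in>Z. mfps_var j * (h(i := q)) j) = (\<Sum>j\<in>Z. mfps_var j * h j)"
    using insert.hyps by (intro sum.cong) auto
  ultimately have "f = (\<Sum>j\<in>insert i Z. mfps_var j * (h(i := q)) j)"
    using insert.hyps by (simp add: algebra_simps)
  thus ?case by blast
qed

text \<open>A form of Taylor's theorem: with a second set of variables \<open>z\<close>, the series
  \<open>f(x + z) - f(x)\<close> has only monomials involving some \<open>z\<^sub>j\<close>, and we put \<open>x = F(t)\<close>, \<open>z = t - F(t)\<close>.\<close>

lemma mfps_hom_diff_eq_sum:
  fixes F :: "('v :: finite, 'a :: comm_ring_1) mfps \<Rightarrow> ('v, 'a) mfps"
  assumes F: "mfps_hom F"
  shows "\<exists>h. f - F f = (\<Sum>j\<in>UNIV. (mfps_var j - F (mfps_var j)) * h j)"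
proof -
  let ?x = "\<lambda>j. mfps_var (Inl j) :: ('v + 'v, 'a) mfps"
  let ?z = "\<lambda>j. mfps_var (Inr j) :: ('v + 'v, 'a) mfps"
  let ?t = "mfps_var :: 'v \<Rightarrow> ('v, 'a) mfps"
  \<comment> \<open>The sum type supplies \<open>x\<close> as \<open>Inl\<close> and
    \<open>z\<close> as \<open>Inr\<close>. Thus \<open>T f\<close> is \<open>f(x + z)\<close>,
    \<open>T0 f\<close> is \<open>f(x)\<close>, \<open>R\<close> sets \<open>z = 0\<close>, and
    \<open>W\<close> puts \<open>x = F(t)\<close>, \<open>z = t - F(t)\<close>, so that
    \<open>x + z\<close> becomes \<open>t\<close> again.\<close>
  define T where "T = mfps_subst_on UNIV (\<lambda>j. ?x j + ?z j)"
  define T0 where "T0 = mfps_subst_on UNIV ?x"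
  define R where "R = mfps_subst_on (range Inl) (mfps_var :: 'v + 'v \<Rightarrow> ('v + 'v, 'a) mfps)"
  define W where "W = mfps_subst_on UNIV (case_sum (\<lambda>j. F (?t j)) (\<lambda>j. ?t j - F (?t j)))"
  have ordF: "mfps_order_ge (Suc 0) (F (?t j))" for j
    by (rule mfps_hom_order_ge[OF F mfps_order_ge_var])
  have T: "mfps_hom T" "T (?t j) = ?x j + ?z j" for j
    by (auto simp: T_def mfps_order_ge_add mfps_order_ge_var
        intro!: mfps_hom_subst_on mfps_subst_on_var)
  have T0: "mfps_hom T0" "T0 (?t j) = ?x j" for j
    by (auto simp: T0_def mfps_order_ge_var intro!: mfps_hom_subst_on mfps_subst_on_var)
  have R: "mfps_hom R" "R (?x j) = ?x j" for j
    by (auto simp: R_def mfps_order_ge_var intro!: mfps_hom_subst_on mfps_subst_on_var)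
  have Rz: "R (?z j) = 0" for j
    by (rule mfps_eqI) (auto simp: R_def mfps_coeff_subst_on_var mfps_var.rep_eq zero_mfps.rep_eq)
  have W: "mfps_hom W" "W (?x j) = F (?t j)" "W (?z j) = ?t j - F (?t j)" for j
    by (auto simp: W_def mfps_subst_on_var ordF mfps_order_ge_diff mfps_order_ge_var
        intro!: mfps_hom_subst_on split: sum.splits)
  have UN: "f \<in> carrier (mfps_ring UNIV)" for f :: "('v, 'a) mfps"
    by (simp add: mfps_ring_simps)
  have RT: "R (T f) = T0 f"
    by (rule mfps_hom_eqI[OF mfps_hom_comp[OF R(1) T(1)] T0(1) finite _ UN])
       (simp add: T T0 R Rz mfps_hom_add[OF R(1)])
  have RT0: "R (T0 f) = T0 f"
    by (rule mfps_hom_eqI[OF mfps_hom_comp[OF R(1) T0(1)] T0(1) finite _ UN]) (simp add: T0 R)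
  have WT: "W (T f) = f"
    by (rule mfps_hom_eqI[OF mfps_hom_comp[OF W(1) T(1)] mfps_hom_id finite _ UN])
       (simp add: T W mfps_hom_add[OF W(1)])
  have WT0: "W (T0 f) = F f"
    by (rule mfps_hom_eqI[OF mfps_hom_comp[OF W(1) T0(1)] F finite _ UN]) (simp add: T0 W)
  \<comment> \<open>At \<open>z = 0\<close> the two series agree, so every monomial of their
    difference contains some \<open>z\<close> variable and the splitting lemma applies with
    \<open>Z = range Inr\<close>.\<close>
  have "\<exists>h. T f - T0 f = (\<Sum>j\<in>range Inr. mfps_var j * h j)"
  proof (rule mfps_eq_sum_var_mult)
    fix m assume nz: "mfps_coeff (T f - T0 f) m \<noteq> 0"
    have "mfps_coeff (R (T f - T0 f)) m = 0"
      by (simp add: mfps_hom_diff[OF R(1)] RT RT0 zero_mfps.rep_eq)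
    with nz have "\<not> keys m \<subseteq> range Inl"
      by (auto simp: R_def mfps_coeff_subst_on_var)
    then obtain x where x: "x \<in> keys m" "x \<notin> range Inl" by blast
    from x(2) have "x \<in> range Inr" by (cases x) auto
    with x(1) show "keys m \<inter> range Inr \<noteq> {}" by blast
  qed simp
  then obtain h where h: "T f - T0 f = (\<Sum>j\<in>range Inr. mfps_var j * h j)" ..
  have "f - F f = W (T f - T0 f)"
    by (simp add: mfps_hom_diff[OF W(1)] WT WT0)
  also have "\<dots> = (\<Sum>j\<in>UNIV. (?t j - F (?t j)) * W (h (Inr j)))"
    unfolding h by (simp add: sum.reindex mfps_hom_simps[OF W(1)] W)
  finally show ?thesis by (rule exI[of _ "\<lambda>j. W (h (Inr j))"])
qed


section \<open>Ideals of power series\<close>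

text \<open>Closure under negation is multiplication by \<open>- 1\<close>, and commutativity turns
  absorption on one side into absorption on both.\<close>

lemma mfps_ideal_iff:
  "ideal J (mfps_ring V :: ('v, 'a :: comm_ring_1) mfps ring) \<longleftrightarrow>
     J \<subseteq> carrier (mfps_ring V) \<and> 0 \<in> J \<and> (\<forall>f\<in>J. \<forall>g\<in>J. f + g \<in> J)
       \<and> (\<forall>f\<in>J. \<forall>g\<in>carrier (mfps_ring V). g * f \<in> J)" (is "?L \<longleftrightarrow> ?R")
proof
  interpret R: cring "mfps_ring V :: ('v, 'a) mfps ring"
    by (rule cring_mfps_ring)
  show ?R if ?L
  proof -
    interpret ideal J "mfps_ring V" by (rule that)
    show ?thesis
      using a_subset additive_subgroup.zero_closed[OF is_additive_subgroup] a_closed I_l_closed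
      by (auto simp: mfps_ring_simps)
  qed
  have uminus: "\<ominus>\<^bsub>mfps_ring V\<^esub> f = - f" if "f \<in> carrier (mfps_ring V)" for f :: "('v, 'a) mfps"
    using that by (intro R.minus_equality) (auto simp: mfps_ring_simps uminus_mfps.rep_eq)
  show ?L if J: ?R
  proof (rule idealI)
    show "ring (mfps_ring V :: ('v, 'a) mfps ring)" by (rule R.ring_axioms)
    show "subgroup J (add_monoid (mfps_ring V))"
    proof (rule R.add.subgroupI)
      show "J \<subseteq> carrier (mfps_ring V)" "J \<noteq> {}" using J by auto
      show "f \<oplus>\<^bsub>mfps_ring V\<^esub> g \<in> J" if "f \<in> J" "g \<in> J" for f g
        using J that by (simp add: mfps_ring_simps)
      show "\<ominus>\<^bsub>mfps_ring V\<^esub> f \<in> J" if "f \<in> J" for f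
      proof -
        have f: "f \<in> carrier (mfps_ring V)" using J that by blast
        have "(- 1 :: ('v, 'a) mfps) \<in> carrier (mfps_ring V)"
          by (auto simp: mfps_ring_simps uminus_mfps.rep_eq one_mfps.rep_eq)
        with J that have "- 1 * f \<in> J" by blast
        thus ?thesis using uminus[OF f] by simp
      qed
    qed
  qed (use J in \<open>auto simp: mfps_ring_simps mult.commute\<close>)
qed

lemma mfps_ideal_sum:
  assumes "ideal J (mfps_ring V)" "\<And>i. i \<in> S \<Longrightarrow> f i \<in> J"
  shows "(\<Sum>i\<in>S. f i) \<in> J"
  using assms(2) by (induction S rule: infinite_finite_induct) (use assms(1) in \<open>auto simp: mfps_ideal_iff\<close>)

lemma mfps_ideal_uminus:
  fixes f :: "('v, 'a :: comm_ring_1) mfps"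
  assumes "ideal J (mfps_ring V)" "f \<in> J"
  shows "- f \<in> J"
proof -
  have "(- 1 :: ('v, 'a) mfps) \<in> carrier (mfps_ring V)"
    by (auto simp: mfps_ring_simps uminus_mfps.rep_eq one_mfps.rep_eq)
  with assms have "- 1 * f \<in> J"
    unfolding mfps_ideal_iff by blast
  thus ?thesis by simp
qed

lemma mfps_genideal_minimal:
  assumes "ideal J (mfps_ring V)" "S \<subseteq> J"
  shows "Idl\<^bsub>mfps_ring V\<^esub> S \<subseteq> J"
  using ring.genideal_minimal[OF cring.axioms(1)[OF cring_mfps_ring] assms] .

lemma mfps_genideal:
  assumes "S \<subseteq> carrier (mfps_ring V)"
  shows "ideal (Idl\<^bsub>mfps_ring V\<^esub> S) (mfps_ring V)" "S \<subseteq> Idl\<^bsub>mfps_ring V\<^esub> S"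
  using assms ring.genideal_ideal ring.genideal_self cring.axioms(1)[OF cring_mfps_ring] by blast+

lemma carrier_t_ring [simp]: "carrier t_ring = UNIV"
  by (simp add: mfps_ring_simps)

lemma mem_set_add_mfps: "f \<in> I <+>\<^bsub>mfps_ring V\<^esub> J \<longleftrightarrow> (\<exists>g\<in>I. \<exists>h\<in>J. f = g + h)"
  by (auto simp: set_add_def' mfps_ring_simps)

text \<open>Together with \<open>mfps_genideal_minimal\<close> this reduces showing that
  \<open>F\<close> maps a generated ideal into \<open>J\<close> to checking the generators.\<close>

lemma mfps_ideal_vimage:
  assumes F: "mfps_hom F" and J: "ideal J (mfps_ring V)"
    and FU: "\<And>f. f \<in> carrier (mfps_ring U) \<Longrightarrow> F f \<in> carrier (mfps_ring V)"
  shows "ideal {f \<in> carrier (mfps_ring U). F f \<in> J} (mfps_ring U)"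
proof -
  interpret U: cring "mfps_ring U :: ('a, 'b) mfps ring"
    by (rule cring_mfps_ring)
  show ?thesis
    using J FU U.add.m_closed U.m_closed U.zero_closed
    unfolding mfps_ideal_iff by (auto simp: mfps_hom_simps[OF F] mfps_ring_simps(2-5))
qed


section \<open>A linear retraction onto the kernel\<close>

text \<open>The \<open>c k\<close> are the rows of a left inverse \<open>C\<close> of
  \<open>B\<close>. The matrix \<open>1 - B C\<close> kills every \<open>b l\<close>, hence the
  kernel of \<open>A\<close>, so it factors through \<open>A\<close>; the factor is
  \<open>Y\<close>.\<close>

lemma kernel_retraction:
  fixes A :: "int ^ 'n ^ 'd" and b :: "nat \<Rightarrow> complex ^ 'n"
  assumes "basis_of_L A r b"
  obtains c :: "nat \<Rightarrow> complex ^ 'n" and Y :: "complex ^ 'd ^ 'n"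
  where "\<And>k l. k < r \<Longrightarrow> l < r \<Longrightarrow> (\<Sum>j\<in>UNIV. c k $ j * b l $ j) = (if k = l then 1 else 0)"
    and "\<And>i j. (if i = j then 1 else 0) - (\<Sum>k<r. b k $ j * c k $ i)
            = (\<Sum>p\<in>UNIV. Y $ j $ p * of_int (A $ p $ i))"
proof -
  have inj: "inj_on b {..<r}" and indep: "vec.independent (b ` {..<r})"
    and span: "vec.span (b ` {..<r}) = L_cplx A"
    using assms by (auto simp: basis_of_L_def)
  have "\<exists>g. Vector_Spaces.linear (*s) (*s) g \<and>
      (\<forall>x\<in>b ` {..<r}. g x = (if x = b k then 1 else 0 :: complex ^ 'n))" for k
    by (rule vec.linear_independent_extend[OF indep])
  then obtain g where g: "\<And>k. Vector_Spaces.linear (*s) (*s) (g k)"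
    "\<And>k x. x \<in> b ` {..<r} \<Longrightarrow> g k x = (if x = b k then 1 else 0 :: complex ^ 'n)"
    by metis
  \<comment> \<open>The functional dual to \<open>b k\<close> is encoded by a vector-valued
    \<open>g k\<close>, which sends \<open>b k\<close> to the all-ones vector and the other basis
    vectors to \<open>0\<close>. Every coordinate therefore gives the same values on the basis, and
    the choice of \<open>undefined\<close> is harmless.\<close>
  define c where "c k = matrix (g k) $ undefined" for k
  have c: "(\<Sum>j\<in>UNIV. c k $ j * b l $ j) = (if k = l then 1 else 0)" if "k < r" "l < r" for k l
  proof -
    have "(\<Sum>j\<in>UNIV. c k $ j * b l $ j) = (matrix (g k) *v b l) $ undefined"
      by (simp add: c_def matrix_vector_mult_def)
    also have "\<dots> = g k (b l) $ undefined"
      by (simp add: matrix_works[OF g(1)])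
    also have "\<dots> = (if k = l then 1 else 0)"
      using g(2)[of "b l" k] that inj by (auto simp: inj_on_def)
    finally show ?thesis .
  qed
  define M :: "complex ^ 'n ^ 'd" where "M = map_matrix of_int A"
  define Q :: "complex ^ 'n ^ 'n" where
    "Q = (\<chi> j i. (if i = j then 1 else 0) - (\<Sum>k<r. b k $ j * c k $ i))"
  have Qb: "Q *v b l = 0" if "l < r" for l
  proof -
    have "(Q *v b l) $ j = 0" for j
    proof -
      have "(Q *v b l) $ j
          = (\<Sum>i\<in>UNIV. ((if i = j then 1 else 0) - (\<Sum>k<r. b k $ j * c k $ i)) * b l $ i)"
        by (simp add: Q_def matrix_vector_mult_def)
      also have "\<dots> = b l $ j - (\<Sum>i\<in>UNIV. \<Sum>k<r. b k $ j * (c k $ i * b l $ i))"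
      proof -
        have "(\<Sum>i\<in>UNIV. (if i = j then 1 else 0) * b l $ i) = (\<Sum>i\<in>UNIV. if i = j then b l $ i else 0)"
          by (intro sum.cong) auto
        thus ?thesis
          unfolding left_diff_distrib sum_subtractf by (simp add: sum_distrib_right mult.assoc)
      qed
      also have "(\<Sum>i\<in>UNIV. \<Sum>k<r. b k $ j * (c k $ i * b l $ i)) = b l $ j"
      proof -
        have "(\<Sum>i\<in>UNIV. \<Sum>k<r. b k $ j * (c k $ i * b l $ i))
            = (\<Sum>k<r. b k $ j * (\<Sum>i\<in>UNIV. c k $ i * b l $ i))"
          by (subst sum.swap) (simp add: sum_distrib_left)
        also have "\<dots> = (\<Sum>k<r. if k = l then b k $ j else 0)"
          using that by (intro sum.cong) (auto simp: c)
        also have "\<dots> = b l $ j" using that by simp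
        finally show ?thesis .
      qed
      finally show ?thesis by simp
    qed
    thus ?thesis by (simp add: vec_eq_iff)
  qed
  have Q_ker: "Q *v x = 0" if "M *v x = 0" for x
  proof -
    have "x \<in> vec.span (b ` {..<r})"
      using that by (simp add: span L_cplx_def M_def)
    thus ?thesis
      by (rule vec.span_induct)
         (auto simp: Qb vec.subspace_def matrix_vector_right_distrib vec.scale)
  qed
  \<comment> \<open>\<open>R\<close> inverts \<open>M\<close> on its range, so
    \<open>x - R (M *v x)\<close> lies in the kernel of \<open>M\<close> and is killed by
    \<open>Q\<close>; this yields the factorization of \<open>Q\<close> through
    \<open>M\<close>.\<close>
  obtain R where R: "Vector_Spaces.linear (*s) (*s) R" "\<And>x. M *v R (M *v x) = M *v x"
    using vec.linear_exists_right_inverse_on[OF matrix_vector_mul_linear_gen[of M] vec.subspace_UNIV]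
    by auto
  have "Q *v x = (Q ** matrix R ** M) *v x" for x
  proof -
    have "Q *v (x - R (M *v x)) = 0"
      by (rule Q_ker) (simp add: matrix_vector_mult_diff_distrib R)
    thus ?thesis
      by (simp add: matrix_vector_mult_diff_distrib matrix_works[OF R(1)] flip: matrix_vector_mul_assoc)
  qed
  hence Q: "Q = (Q ** matrix R) ** M"
    by (simp add: matrix_eq)
  show ?thesis
  proof (rule that[of c "Q ** matrix R"])
    fix i j
    have "Q $ j $ i = (\<Sum>p\<in>UNIV. (Q ** matrix R) $ j $ p * M $ p $ i)"
      by (subst Q) (simp add: matrix_matrix_mult_def)
    thus "(if i = j then 1 else 0) - (\<Sum>k<r. b k $ j * c k $ i)
            = (\<Sum>p\<in>UNIV. (Q ** matrix R) $ j $ p * of_int (A $ p $ i))"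
      by (simp add: Q_def M_def map_matrix_def)
  qed (rule c)
qed


section \<open>The ambient and the intrinsic side\<close>

context
  fixes A :: "int ^ 'n ^ 'd" and b :: "nat \<Rightarrow> complex ^ 'n" and r :: nat
begin

lemma mfps_order_ge_Bs: "mfps_order_ge (Suc 0) (Bs r b j)"
  unfolding Bs_def using mfps_order_ge_var
  by (intro mfps_order_ge_sum mfps_order_ge_const_mult) simp

lemma mfps_hom_Phi: "mfps_hom (Phi r b)"
  unfolding Phi_def mfps_subst_eq by (intro mfps_hom_subst_on mfps_order_ge_Bs) simp

lemma Phi_var: "Phi r b (mfps_var j) = Bs r b j"
  unfolding Phi_def mfps_subst_eq by (intro mfps_subst_on_var mfps_order_ge_Bs) simp_all

text \<open>The projection onto the variables below \<open>r\<close> fixes each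
  \<open>Bs r b j\<close>, so composing it with \<open>Phi\<close> gives a continuous homomorphism
  with the same values on the variables, and \<open>mfps_hom_eqI\<close> makes the two
  equal.\<close>

lemma Phi_in_s_ring: "Phi r b f \<in> carrier (s_ring r)"
proof -
  let ?R = "mfps_subst_on {..<r} mfps_var :: (nat, complex) mfps \<Rightarrow> _"
  have R: "mfps_hom ?R" "\<And>k. k < r \<Longrightarrow> ?R (mfps_var k) = mfps_var k"
    by (auto intro!: mfps_hom_subst_on mfps_subst_on_var mfps_order_ge_var)
  have R_Phi: "?R (Phi r b f) = Phi r b f"
    by (rule mfps_hom_eqI[OF mfps_hom_comp[OF R(1) mfps_hom_Phi] mfps_hom_Phi, of UNIV])
       (simp_all add: Phi_var Bs_def mfps_hom_simps[OF R(1)] R(2))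
  have "mfps_coeff (Phi r b f) m = 0" if "\<not> keys m \<subseteq> {..<r}" for m
    using that by (subst R_Phi[symmetric], subst mfps_coeff_subst_on_var) simp_all
  thus ?thesis by (auto simp: mfps_ring_simps)
qed

lemma Phi_t_monom: "Phi r b (t_monom S) = Bs_monom r b S"
  by (simp add: t_monom_def Bs_monom_def mfps_hom_prod[OF mfps_hom_Phi] Phi_var)

lemma At_ideal: "ideal (At_ideal A) t_ring"
    and At_gen: "(\<Sum>j\<in>UNIV. mfps_const (of_int (A $ i $ j)) * mfps_var j) \<in> At_ideal A"
  using mfps_genideal[of "range (\<lambda>i. \<Sum>j\<in>UNIV.
      mfps_const (of_int (A $ i $ j)) * mfps_var j :: ('n, complex) mfps)" UNIV]
  by (auto simp: At_ideal_def)

text \<open>The image of the generator for row \<open>i\<close> has as its coefficient at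
  \<open>s_k\<close> the \<open>i\<close>-th entry of \<open>A\<close> applied to
  \<open>b k\<close>, and \<open>b k\<close> is in the kernel of \<open>A\<close>.\<close>

lemma Phi_At_ideal:
  assumes "basis_of_L A r b" "f \<in> At_ideal A"
  shows "Phi r b f = 0"
proof -
  have b: "(\<Sum>j\<in>UNIV. of_int (A $ i $ j) * b k $ j) = 0" if "k < r" for i k
  proof -
    have "b k \<in> L_cplx A"
      using assms(1) that vec.span_base[of "b k" "b ` {..<r}"] by (auto simp: basis_of_L_def)
    hence "map_matrix of_int A *v b k = (0 :: complex ^ 'd)"
      by (simp add: L_cplx_def)
    hence "(map_matrix of_int A *v b k) $ i = (0 :: complex)"
      by simp
    thus ?thesis by (simp add: matrix_vector_mult_def map_matrix_def)
  qed
  have gen: "Phi r b (\<Sum>j\<in>UNIV. mfps_const (of_int (A $ i $ j)) * mfps_var j) = 0" for i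
  proof -
    have "Phi r b (\<Sum>j\<in>UNIV. mfps_const (of_int (A $ i $ j)) * mfps_var j)
        = (\<Sum>j\<in>UNIV. \<Sum>k<r. mfps_const (of_int (A $ i $ j) * b k $ j) * mfps_var k)"
      by (simp add: mfps_hom_simps[OF mfps_hom_Phi] Phi_var Bs_def sum_distrib_left mfps_const_mult
          mult.assoc)
    also have "\<dots> = (\<Sum>k<r. mfps_const (\<Sum>j\<in>UNIV. of_int (A $ i $ j) * b k $ j) * mfps_var k)"
      by (subst sum.swap) (simp add: mfps_const_sum sum_distrib_right)
    also have "\<dots> = 0" by (simp add: b)
    finally show ?thesis .
  qed
  have "ideal {f \<in> carrier t_ring. Phi r b f \<in> {0}} t_ring"
    by (rule mfps_ideal_vimage[OF mfps_hom_Phi, of _ UNIV]) (auto simp: mfps_ideal_iff mfps_ring_simps zero_mfps.rep_eq)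
  hence "At_ideal A \<subseteq> {f \<in> carrier t_ring. Phi r b f \<in> {0}}"
    unfolding At_ideal_def by (rule mfps_genideal_minimal) (auto simp: gen)
  thus ?thesis using assms(2) by auto
qed

text \<open>The second property gives surjectivity onto \<open>s_ring r\<close>. The third puts
  every \<open>f\<close> with \<open>Phi r b f = 0\<close> into \<open>At_ideal A\<close>, so with
  \<open>Phi_At_ideal\<close> it identifies the kernel.\<close>

lemma Phi_section:
  assumes "basis_of_L A r b"
  obtains \<Psi> :: "(nat, complex) mfps \<Rightarrow> ('n, complex) mfps" where "mfps_hom \<Psi>"
    "\<And>f. f \<in> carrier (s_ring r) \<Longrightarrow> Phi r b (\<Psi> f) = f"
    "\<And>f. f - \<Psi> (Phi r b f) \<in> At_ideal A"
proof -
  obtain c :: "nat \<Rightarrow> complex ^ 'n" and Y :: "complex ^ 'd ^ 'n"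
    where c: "\<And>k l. k < r \<Longrightarrow> l < r \<Longrightarrow> (\<Sum>j\<in>UNIV. c k $ j * b l $ j) = (if k = l then 1 else 0)"
      and Y: "\<And>i j. (if i = j then 1 else 0) - (\<Sum>k<r. b k $ j * c k $ i)
            = (\<Sum>p\<in>UNIV. Y $ j $ p * of_int (A $ p $ i))"
    by (rule kernel_retraction[OF assms], rule that, blast+)
  let ?C = "\<lambda>k. \<Sum>j\<in>UNIV. mfps_const (c k $ j) * mfps_var j :: ('n, complex) mfps"
  define \<Psi> where "\<Psi> = mfps_subst_on {..<r} ?C"
  have ordC: "mfps_order_ge (Suc 0) (?C k)" for k
    using mfps_order_ge_var by (intro mfps_order_ge_sum mfps_order_ge_const_mult) simp
  have \<Psi>: "mfps_hom \<Psi>" and \<Psi>_var: "\<And>k. k < r \<Longrightarrow> \<Psi> (mfps_var k) = ?C k"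
    unfolding \<Psi>_def by (auto intro!: mfps_hom_subst_on mfps_subst_on_var ordC)
  have "Phi r b (?C k) = mfps_var k" if "k < r" for k
  proof -
    have "Phi r b (?C k) = (\<Sum>j\<in>UNIV. \<Sum>l<r. mfps_const (c k $ j * b l $ j) * mfps_var l)"
      by (simp add: mfps_hom_simps[OF mfps_hom_Phi] Phi_var Bs_def sum_distrib_left mfps_const_mult
          mult.assoc)
    also have "\<dots> = (\<Sum>l<r. mfps_const (\<Sum>j\<in>UNIV. c k $ j * b l $ j) * mfps_var l)"
      by (subst sum.swap) (simp add: mfps_const_sum sum_distrib_right)
    also have "\<dots> = (\<Sum>l<r. if l = k then mfps_var l else 0)"
      using that by (intro sum.cong) (auto simp: c)
    finally show ?thesis using that by simp
  qed
  hence Phi_\<Psi>: "Phi r b (\<Psi> f) = f" if "f \<in> carrier (s_ring r)" for f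
    by (intro mfps_hom_eqI[OF mfps_hom_comp[OF mfps_hom_Phi \<Psi>] mfps_hom_id _ _ that])
       (simp_all add: \<Psi>_var)
  \<comment> \<open>This linear form has row \<open>j\<close> of \<open>1 - B C\<close> as its
    coefficients; by the factorization through \<open>A\<close> it is the combination of the
    generators of \<open>At_ideal A\<close> with coefficients \<open>Y $ j $ p\<close>.\<close>
  have var: "mfps_var j - \<Psi> (Phi r b (mfps_var j)) \<in> At_ideal A" for j
  proof -
    have "(\<Sum>i\<in>UNIV. mfps_const (if i = j then 1 else 0) * mfps_var i)
        = (\<Sum>i\<in>UNIV. if i = j then mfps_var i else 0 :: ('n, complex) mfps)"
      by (intro sum.cong) auto
    hence one: "mfps_var j
        = (\<Sum>i\<in>UNIV. mfps_const (if i = j then 1 else 0) * mfps_var i :: ('n, complex) mfps)"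
      by simp
    have "\<Psi> (Phi r b (mfps_var j)) = (\<Sum>k<r. \<Sum>i\<in>UNIV. mfps_const (b k $ j * c k $ i) * mfps_var i)"
      by (simp add: Phi_var Bs_def mfps_hom_simps[OF \<Psi>] \<Psi>_var sum_distrib_left mfps_const_mult mult.assoc)
    also have "\<dots> = (\<Sum>i\<in>UNIV. mfps_const (\<Sum>k<r. b k $ j * c k $ i) * mfps_var i)"
      by (subst sum.swap) (simp add: mfps_const_sum sum_distrib_right)
    finally have "mfps_var j - \<Psi> (Phi r b (mfps_var j))
        = (\<Sum>i\<in>UNIV. mfps_const (if i = j then 1 else 0) * mfps_var i)
          - (\<Sum>i\<in>UNIV. mfps_const (\<Sum>k<r. b k $ j * c k $ i) * mfps_var i)"
      by (simp only: flip: one)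
    also have "\<dots> = (\<Sum>i\<in>UNIV. (mfps_const (if i = j then 1 else 0)
            - mfps_const (\<Sum>k<r. b k $ j * c k $ i)) * mfps_var i)"
      by (simp only: left_diff_distrib sum_subtractf)
    also have "\<dots> = (\<Sum>i\<in>UNIV. mfps_const (\<Sum>p\<in>UNIV. Y $ j $ p * of_int (A $ p $ i)) * mfps_var i)"
      by (simp only: mfps_const_diff flip: Y)
    also have "\<dots> = (\<Sum>p\<in>UNIV. mfps_const (Y $ j $ p)
        * (\<Sum>i\<in>UNIV. mfps_const (of_int (A $ p $ i)) * mfps_var i))"
      unfolding mfps_const_sum sum_distrib_right sum_distrib_left mfps_const_mult mult.assoc
      by (rule sum.swap)
    also have "\<dots> \<in> At_ideal A"
      by (intro mfps_ideal_sum[OF At_ideal]) (use At_ideal At_gen in \<open>simp add: mfps_ideal_iff\<close>)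
    finally show ?thesis .
  qed
  have "f - \<Psi> (Phi r b f) \<in> At_ideal A" for f
  proof -
    \<comment> \<open>The Taylor formula for the composite of \<open>\<Psi>\<close> and
      \<open>Phi\<close> reduces an arbitrary series to the variables.\<close>
    from mfps_hom_diff_eq_sum[OF mfps_hom_comp[OF \<Psi> mfps_hom_Phi], of f]
    obtain h where h: "f - \<Psi> (Phi r b f)
        = (\<Sum>j\<in>UNIV. (mfps_var j - \<Psi> (Phi r b (mfps_var j))) * h j)" ..
    show ?thesis
      unfolding h
      by (intro mfps_ideal_sum[OF At_ideal], subst mult.commute)
         (use At_ideal var in \<open>simp add: mfps_ideal_iff\<close>)
  qed
  with \<Psi> Phi_\<Psi> show ?thesis by (rule that)
qed

end

theorem proposition6p8:
  fixes A :: "int ^ 'n ^ 'd"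
    and \<beta> :: "complex ^ 'd"
    and w :: "real ^ 'n"
    and v\<^sub>0 :: "complex ^ 'n"
    and N :: "'n set set"
    and b :: "nat \<Rightarrow> complex ^ 'n"
    and r :: nat
  assumes rank: "rank (map_matrix of_int A :: rat ^ 'n ^ 'd) = CARD('d)"
    and hyperplane: "columns_in_hyperplane A"
    and generic: "generic_weight A w"
    and fake_exponent: "fake_exponent A \<beta> w v\<^sub>0"
    and r: "r = CARD('n) - CARD('d)"
    and basis: "basis_of_L A r b"
    and family: "neg_supp_family A w v\<^sub>0 N"
    and ordered: "ordered_family A v\<^sub>0 N"
    and colon_eq: "\<exists>I\<in>N. colon t_ring (Q_hat A v\<^sub>0 N) (m_hat v\<^sub>0 N * t_monom (I - \<Inter>N))
                      = colon t_ring (Q_hat A v\<^sub>0 N) (m_hat v\<^sub>0 N)"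
  shows "Phi r b ` colon t_ring (Q_hat A v\<^sub>0 N) (m_hat v\<^sub>0 N)
           = colon (s_ring r) (P_int A r b v\<^sub>0 N) (m_int r b v\<^sub>0 N)"
proof -
  let ?P = "P_hat A v\<^sub>0 N" and ?Q = "Q_hat A v\<^sub>0 N" and ?P' = "P_int A r b v\<^sub>0 N"
    and ?At = "At_ideal A" and ?m = "m_hat v\<^sub>0 N" and ?m' = "m_int r b v\<^sub>0 N"
  let ?G = "{t_monom ((I \<union> J) - \<Inter>N) | I J. I \<in> N \<and> J \<in> NS A v\<^sub>0 - N}"
    and ?G' = "{Bs_monom r b ((I \<union> J) - \<Inter>N) | I J. I \<in> N \<and> J \<in> NS A v\<^sub>0 - N}"
  have P: "ideal ?P t_ring" "?G \<subseteq> ?P"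
    unfolding P_hat_def by (rule mfps_genideal; simp)+
  have "Bs_monom r b S \<in> carrier (s_ring r)" for S
    using Phi_in_s_ring[of r b "t_monom S"] by (simp only: Phi_t_monom)
  hence "?G' \<subseteq> carrier (s_ring r)" by blast
  hence P': "ideal ?P' (s_ring r)" "?G' \<subseteq> ?P'"
    unfolding P_int_def by (rule mfps_genideal)+
  have M: "ideal (M_hat N) t_ring" "\<And>I. I \<in> N \<Longrightarrow> t_monom (I - \<Inter>N) \<in> M_hat N"
    using mfps_genideal[of "{t_monom (I - \<Inter>N) |I. I \<in> N}" UNIV] by (auto simp: M_hat_def)
  note At = At_ideal[of A]
  have m: "Phi r b ?m = ?m'"
    by (simp add: m_hat_def m_int_def Phi_t_monom)
  obtain \<Psi> :: "(nat, complex) mfps \<Rightarrow> ('n, complex) mfps" where \<Psi>: "mfps_hom \<Psi>"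
    "\<And>f. f \<in> carrier (s_ring r) \<Longrightarrow> Phi r b (\<Psi> f) = f"
    "\<And>f. f - \<Psi> (Phi r b f) \<in> ?At"
    using Phi_section[OF basis] by blast
  have "?P \<subseteq> {f \<in> carrier t_ring. Phi r b f \<in> ?P'}"
    unfolding P_hat_def
  proof (rule mfps_genideal_minimal)
    show "ideal {f \<in> carrier t_ring. Phi r b f \<in> ?P'} t_ring"
      by (rule mfps_ideal_vimage[OF mfps_hom_Phi P'(1) Phi_in_s_ring])
    show "?G \<subseteq> {f \<in> carrier t_ring. Phi r b f \<in> ?P'}"
    proof clarify
      fix I J assume "I \<in> N" "J \<in> NS A v\<^sub>0" "J \<notin> N"
      hence "Bs_monom r b (I \<union> J - \<Inter>N) \<in> ?P'" using P'(2) by blast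
      thus "t_monom (I \<union> J - \<Inter>N) \<in> carrier t_ring \<and> Phi r b (t_monom (I \<union> J - \<Inter>N)) \<in> ?P'"
        by (simp add: Phi_t_monom)
    qed
  qed
  hence Phi_P: "Phi r b f \<in> ?P'" if "f \<in> ?P" for f
    using that by blast
  have Phi_Q: "Phi r b f \<in> ?P'" if "f \<in> ?Q" for f
  proof -
    obtain g p where fgp: "f = g + p" "g \<in> ?At \<cdot>\<^bsub>t_ring\<^esub> M_hat N" "p \<in> ?P"
      using \<open>f \<in> ?Q\<close> by (auto simp: Q_hat_def mem_set_add_mfps)
    \<comment> \<open>A product of ideals lies in each factor, so \<open>Phi\<close> kills the first
      summand of \<open>?Q\<close>.\<close>
    have "g \<in> ?At"
      using ring.ideal_prod_inter[OF cring.axioms(1)[OF cring_mfps_ring] At M(1)] fgp(2) by blast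
    hence "Phi r b g = 0" by (rule Phi_At_ideal[OF basis])
    thus ?thesis
      using Phi_P fgp by (simp add: mfps_hom_simps[OF mfps_hom_Phi])
  qed
  have PAt: "ideal (?P <+>\<^bsub>t_ring\<^esub> ?At) t_ring"
    by (rule ring.add_ideals[OF cring.axioms(1)[OF cring_mfps_ring] P(1) At])
  \<comment> \<open>Each generator of \<open>?P'\<close> is \<open>Phi r b ?t\<close> for a
    generator \<open>?t\<close> of \<open>?P\<close>, and \<open>\<Psi>\<close> returns it to
    \<open>?t\<close> only up to an element of \<open>?At\<close>.\<close>
  have "?P' \<subseteq> {g \<in> carrier (s_ring r). \<Psi> g \<in> ?P <+>\<^bsub>t_ring\<^esub> ?At}"
    unfolding P_int_def
  proof (rule mfps_genideal_minimal)
    show "ideal {g \<in> carrier (s_ring r). \<Psi> g \<in> ?P <+>\<^bsub>t_ring\<^esub> ?At} (s_ring r)"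
      by (rule mfps_ideal_vimage[OF \<Psi>(1) PAt]) simp
    show "?G' \<subseteq> {g \<in> carrier (s_ring r). \<Psi> g \<in> ?P <+>\<^bsub>t_ring\<^esub> ?At}"
    proof clarify
      fix I J assume IJ: "I \<in> N" "J \<in> NS A v\<^sub>0" "J \<notin> N"
      let ?t = "t_monom (I \<union> J - \<Inter>N)"
      have "\<Psi> (Phi r b ?t) - ?t \<in> ?At"
        using mfps_ideal_uminus[OF At \<Psi>(3)[of ?t]] by simp
      moreover have "?t \<in> ?P" using P(2) IJ by blast
      ultimately have "\<Psi> (Phi r b ?t) \<in> ?P <+>\<^bsub>t_ring\<^esub> ?At"
        unfolding mem_set_add_mfps by (metis add_diff_cancel_left' diff_add_cancel add.commute)
      thus "Bs_monom r b (I \<union> J - \<Inter>N) \<in> carrier (s_ring r)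
          \<and> \<Psi> (Bs_monom r b (I \<union> J - \<Inter>N)) \<in> ?P <+>\<^bsub>t_ring\<^esub> ?At"
        using Phi_in_s_ring[of r b ?t] by (simp add: Phi_t_monom)
    qed
  qed
  hence \<Psi>_P': "\<Psi> g \<in> ?P <+>\<^bsub>t_ring\<^esub> ?At" if "g \<in> ?P'" for g
    using that by blast
  show ?thesis
  proof (intro equalityI subsetI)
    fix g assume "g \<in> Phi r b ` colon t_ring ?Q ?m"
    then obtain f where f: "g = Phi r b f" "f * ?m \<in> ?Q"
      by (auto simp: colon_def mfps_ring_simps)
    have "g * ?m' \<in> ?P'"
      using Phi_Q[OF f(2)] by (simp add: f mfps_hom_mult[OF mfps_hom_Phi] m)
    thus "g \<in> colon (s_ring r) ?P' ?m'"
      using Phi_in_s_ring f(1) by (auto simp: colon_def mfps_ring_simps(2))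
  next
    fix g assume "g \<in> colon (s_ring r) ?P' ?m'"
    hence g: "g \<in> carrier (s_ring r)" "g * ?m' \<in> ?P'"
      by (auto simp: colon_def mfps_ring_simps(2))
    obtain I where I: "I \<in> N" "colon t_ring ?Q (?m * t_monom (I - \<Inter>N)) = colon t_ring ?Q ?m"
      using colon_eq by blast
    \<comment> \<open>The preimage sought is \<open>\<Psi> g\<close>. Modulo \<open>?At\<close>, its
      product with \<open>?m\<close> equals \<open>\<Psi> (g * ?m')\<close>, which splits as
      \<open>p + a\<close>.\<close>
    have "\<Psi> g * ?m - \<Psi> (Phi r b (\<Psi> g * ?m)) \<in> ?At"
      by (rule \<Psi>(3))
    moreover have "Phi r b (\<Psi> g * ?m) = g * ?m'"
      by (simp add: mfps_hom_mult[OF mfps_hom_Phi] \<Psi>(2)[OF g(1)] m)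
    moreover obtain p a where pa: "\<Psi> (g * ?m') = p + a" "p \<in> ?P" "a \<in> ?At"
      using \<Psi>_P'[OF g(2)] by (auto simp: mem_set_add_mfps)
    ultimately have "\<Psi> g * ?m - (p + a) \<in> ?At" by simp
    \<comment> \<open>Adding \<open>a\<close> back leaves \<open>\<Psi> g * ?m - p\<close>, the
      element of \<open>?At\<close> to be multiplied next.\<close>
    with pa(3) have a': "(\<Psi> g * ?m - (p + a)) + a \<in> ?At"
      using At unfolding mfps_ideal_iff by blast
    let ?t = "t_monom (I - \<Inter>N)"
    \<comment> \<open>\<open>?Q\<close> contains \<open>?At\<close> only after multiplication by
      \<open>M_hat N\<close>; the factor \<open>?t\<close> supplies an element of that
      ideal.\<close>
    have "(\<Psi> g * ?m - p) * ?t \<in> ?At \<cdot>\<^bsub>t_ring\<^esub> M_hat N"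
      using ideal_prod.prod[OF a' M(2)[OF I(1)], of t_ring] by (simp add: mfps_ring_simps)
    moreover have "p * ?t \<in> ?P"
      using P(1) pa(2) unfolding mfps_ideal_iff by (simp add: mult.commute)
    ultimately have "\<Psi> g * (?m * ?t) \<in> ?Q"
      unfolding Q_hat_def mem_set_add_mfps
      by (intro bexI[of _ "(\<Psi> g * ?m - p) * ?t"] bexI[of _ "p * ?t"]) (auto simp: algebra_simps)
    \<comment> \<open>The equality of colon ideals for this \<open>I\<close> cancels the factor
      \<open>?t\<close>.\<close>
    hence "\<Psi> g \<in> colon t_ring ?Q ?m"
      unfolding I(2)[symmetric] by (simp add: colon_def mfps_ring_simps)
    thus "g \<in> Phi r b ` colon t_ring ?Q ?m"
      using \<Psi>(2)[OF g(1)] by (intro image_eqI[of _ _ "\<Psi> g"]) simp_all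
  qed
qed

end
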